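(* Let $\varphi:\mathbb{R}^n\to(-\infty,\infty]$ be proper and lower semicontinuous, and let $\varphi$ be $C^2$-strictly decomposable at $\bar x\in\mathrm{dom}(\varphi)$ for $\bar\lambda\in\mathcal{Q}$ with decomposition pair $(\varphi_d,F)$, $\varphi_d=\sigma_{\mathcal{Q}}$, $F$ taking values in $\mathbb{R}^m$. Then $$\mathrm{d}^2_s\varphi(\bar x\,|\,DF(\bar x)^\top\bar\lambda)(h)\;\ge\;\mathrm{d}^2_s\varphi_d(0\,|\,\bar\lambda)(DF(\bar x)h)+\langle\bar\lambda,D^2F(\bar x)[h,h]\rangle\qquad\forall\,h\in\mathbb{R}^n .$$ Furthermore, if $h\in DF(\bar x)^{-1}\mathrm{aff}(N_{\mathcal{Q}}(\bar\lambda))$, then this inequality holds with equality and $\mathrm{d}^2_s\varphi_d(0\,|\,\bar\lambda)(DF(\bar x)h)=0$.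
   Context: $\sigma_{\mathcal Q}$ is the support function of $\mathcal Q$, $N_{\mathcal Q}(\lambda)$ the normal cone of the convex set $\mathcal Q$ at $\lambda$, $\mathrm{aff}$ the affine hull; for a matrix $A$ and a set $C$, $A^{-1}C:=\{h: Ah\in C\}$. $\partial$ denotes the limiting subdifferential: $\hat\partial\theta(x)=\{v:\theta(y)\ge\theta(x)+\langle v,y-x\rangle+o(\|y-x\|)\}$ and $\partial\theta(x)=\limsup_{y\to x,\theta(y)\to\theta(x)}\hat\partial\theta(y)$. Decomposability: $\varphi$ is $C^\ell$-decomposable at $\bar x\in\mathrm{dom}(\varphi)$ with decomposition pair $(\varphi_d,F)$ if there is an open neighborhood $U$ of $\bar x$ with $\varphi(x)=\varphi(\bar x)+\varphi_d(F(x))$ for all $x\in U$, where (i) $F:U\to\mathbb{R}^m$ is $\ell$-times continuously differentiable and $F(\bar x)=0$; (ii) $\varphi_d=\sigma_{\mathcal Q}:\mathbb{R}^m\to(-\infty,\infty]$ for some nonempty closed convex set $\mathcal Q\subseteq\mathbb{R}^m$; (iii) $0\in\mathrm{int}\{DF(\bar x)\mathbb{R}^n-\mathrm{dom}(\varphi_d)\}$. It is $C^\ell$-strictly decomposable at $\bar x$ for $\bar\lambda\in\mathcal Q$ if in addition $DF(\bar x)\mathbb{R}^n-N_{\mathcal Q}(\bar\lambda)=\mathbb{R}^m$. Strict second subderivative: with $\Delta_t^2\theta(x|v)(h):=\frac{\theta(x+th)-\theta(x)-t\langle v,h\rangle}{\frac12t^2}$, for $\bar v\in\partial\theta(\bar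 x)$, $$\mathrm{d}^2_s\theta(\bar x|\bar v)(h):=\liminf_{t\downarrow0,\ \tilde h\to h,\ \theta(x)\to\theta(\bar x),\ \mathrm{gph}(\partial\theta)\ni(x,v)\to(\bar x,\bar v)}\Delta_t^2\theta(x|v)(\tilde h).$$ *)

theory Defs
  imports "HOL-Analysis.Analysis" "HOL-Library.Landau_Symbols"
begin

section \<open>Extended real-valued functions\<close>

definition edom :: "('a \<Rightarrow> ereal) \<Rightarrow> 'a set" where
  "edom \<theta> = {x. \<theta> x < \<infinity>}"

definition proper_fun :: "('a \<Rightarrow> ereal) \<Rightarrow> bool" where
  "proper_fun \<theta> \<longleftrightarrow> (\<forall>x. \<theta> x \<noteq> -\<infinity>) \<and> edom \<theta> \<noteq> {}"

definition lsc_fun :: "('a::topological_space \<Rightarrow> ereal) \<Rightarrow> bool" where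
  "lsc_fun \<theta> \<longleftrightarrow> (\<forall>x. \<theta> x \<le> Liminf (at x) \<theta>)"

definition support_fun :: "'a::real_inner set \<Rightarrow> 'a \<Rightarrow> ereal" where
  "support_fun Q y = (SUP q\<in>Q. ereal (q \<bullet> y))"

text \<open>The normal cone of convex analysis; it is empty at points outside the set.\<close>

definition normal_cone :: "'a::real_inner set \<Rightarrow> 'a \<Rightarrow> 'a set" where
  "normal_cone Q x = (if x \<in> Q then {v. \<forall>q\<in>Q. v \<bullet> (q - x) \<le> 0} else {})"

section \<open>Subdifferentials and the strict second subderivative\<close>

text \<open>Both subdifferentials are empty where \<open>\<theta>\<close> is not finite.\<close>

definition regular_subdiff :: "('a::real_inner \<Rightarrow> ereal) \<Rightarrow> 'a \<Rightarrow> 'a set" where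
  "regular_subdiff \<theta> x = {v. \<bar>\<theta> x\<bar> \<noteq> \<infinity> \<and>
     (\<exists>r \<in> o[at x](\<lambda>y. norm (y - x)).
        \<forall>\<^sub>F y in at x. \<theta> y \<ge> \<theta> x + ereal (v \<bullet> (y - x)) + ereal (r y))}"

definition limiting_subdiff :: "('a::real_inner \<Rightarrow> ereal) \<Rightarrow> 'a \<Rightarrow> 'a set" where
  "limiting_subdiff \<theta> x = {v. \<bar>\<theta> x\<bar> \<noteq> \<infinity> \<and>
     (\<exists>y w. y \<longlonglongrightarrow> x \<and> (\<lambda>k. \<theta> (y k)) \<longlonglongrightarrow> \<theta> x \<and>
            (\<forall>k::nat. w k \<in> regular_subdiff \<theta> (y k)) \<and> w \<longlonglongrightarrow> v)}"

definition second_quotient ::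
  "('a::real_inner \<Rightarrow> ereal) \<Rightarrow> 'a \<Rightarrow> 'a \<Rightarrow> real \<Rightarrow> 'a \<Rightarrow> ereal" where
  "second_quotient \<theta> x v t h =
     (\<theta> (x + t *\<^sub>R h) - \<theta> x - ereal (t * (v \<bullet> h))) / ereal (t\<^sup>2 / 2)"

text \<open>The filter on \<open>(x, v)\<close> expresses \<open>(x, v) \<rightarrow> (xb, vb)\<close> within the graph of
  \<open>limiting_subdiff \<theta>\<close> together with \<open>\<theta> x \<rightarrow> \<theta> xb\<close>. On that graph \<open>\<theta> x\<close> is finite,
  so the difference quotient never involves \<open>\<infinity> - \<infinity>\<close>. The notion is meant for
  \<open>vb \<in> limiting_subdiff \<theta> xb\<close>, in which case \<open>x = xb\<close>, \<open>v = vb\<close> is admissible.\<close>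

definition strict_second_subderiv ::
  "('a::real_inner \<Rightarrow> ereal) \<Rightarrow> 'a \<Rightarrow> 'a \<Rightarrow> 'a \<Rightarrow> ereal" where
  "strict_second_subderiv \<theta> xb vb h =
     Liminf (at_right 0 \<times>\<^sub>F nhds h \<times>\<^sub>F
               inf (nhds (xb, vb))
                 (inf (filtercomap (\<lambda>(x, v). \<theta> x) (nhds (\<theta> xb)))
                      (principal {(x, v). v \<in> limiting_subdiff \<theta> x})))
            (\<lambda>(t, h', x, v). second_quotient \<theta> x v t h')"

section \<open>Smooth maps\<close>

text \<open>\<open>C\<^sup>k\<close> on an open set: in finite dimensions, continuity of \<open>x \<mapsto> DF(x)\<close> (and of the higher
  derivatives) amounts to continuity of \<open>x \<mapsto> DF(x) u\<close> for every fixed direction \<open>u\<close>.\<close>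

primrec C_k_on ::
  "nat \<Rightarrow> ('a::euclidean_space \<Rightarrow> 'b::euclidean_space) \<Rightarrow> 'a set \<Rightarrow> bool" where
  "C_k_on 0 F U \<longleftrightarrow> continuous_on U F"
| "C_k_on (Suc k) F U \<longleftrightarrow>
     (\<forall>x\<in>U. F differentiable (at x)) \<and>
     (\<forall>u. C_k_on k (\<lambda>x. frechet_derivative F (at x) u) U)"

definition second_deriv ::
  "('a::euclidean_space \<Rightarrow> 'b::euclidean_space) \<Rightarrow> 'a \<Rightarrow> 'a \<Rightarrow> 'a \<Rightarrow> 'b" where
  "second_deriv F x u v =
     frechet_derivative (\<lambda>y. frechet_derivative F (at y) u) (at x) v"

section \<open>Decomposability\<close>

text \<open>\<open>Q\<close> is the closed convex set that \<open>\<phi>d\<close> is the support function of. Only the values of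
  \<open>F\<close> near \<open>xb\<close> matter.\<close>

definition decomposable_at ::
  "nat \<Rightarrow> (real^'n \<Rightarrow> ereal) \<Rightarrow> real^'n \<Rightarrow> (real^'m \<Rightarrow> ereal) \<Rightarrow> (real^'n \<Rightarrow> real^'m) \<Rightarrow>
   (real^'m) set \<Rightarrow> bool" where
  "decomposable_at l \<phi> xb \<phi>d F Q \<longleftrightarrow>
     xb \<in> edom \<phi> \<and>
     (\<exists>U. open U \<and> xb \<in> U \<and> (\<forall>x\<in>U. \<phi> x = \<phi> xb + \<phi>d (F x)) \<and> C_k_on l F U) \<and>
     F xb = 0 \<and>
     Q \<noteq> {} \<and> closed Q \<and> convex Q \<and> \<phi>d = support_fun Q \<and>
     0 \<in> interior {jacobian F (at xb) *v u - w | u w. w \<in> edom \<phi>d}"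

definition strictly_decomposable_at ::
  "nat \<Rightarrow> (real^'n \<Rightarrow> ereal) \<Rightarrow> real^'n \<Rightarrow> (real^'m \<Rightarrow> ereal) \<Rightarrow> (real^'n \<Rightarrow> real^'m) \<Rightarrow>
   (real^'m) set \<Rightarrow> real^'m \<Rightarrow> bool" where
  "strictly_decomposable_at l \<phi> xb \<phi>d F Q lam \<longleftrightarrow>
     decomposable_at l \<phi> xb \<phi>d F Q \<and> lam \<in> Q \<and>
     {jacobian F (at xb) *v u - w | u w. w \<in> normal_cone Q lam} = UNIV"

end

theory Submission
  imports Defs
begin

text \<open>
  The condition \<open>DF(xb)\<real>\<^sup>n - N\<^sub>Q(lam) = \<real>\<^sup>m\<close> does two jobs. On the dual side it gives
  \<open>\<parallel>q - lam\<parallel> \<le> \<kappa> \<parallel>DF(x)\<^sup>T(q - lam)\<parallel>\<close> for \<open>q \<in> Q\<close> and \<open>x\<close> near \<open>xb\<close>. This compactness turns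
  minimisers of Moreau-regularised problems into the chain rule \<open>\<partial>\<phi>(x) \<subseteq> DF(x)\<^sup>T \<partial>\<sigma>\<^sub>Q(F(x))\<close>, and it
  makes the multiplier \<open>q\<close> of any \<open>(x, v) \<rightarrow> (xb, DF(xb)\<^sup>T lam)\<close> in the graph of \<open>\<partial>\<phi>\<close> tend to \<open>lam\<close>.
  The quotient of \<open>\<phi>\<close> is then one of \<open>\<sigma>\<^sub>Q\<close> plus \<open>q\<close> applied to the second-order Taylor remainder of
  \<open>F\<close>, which yields the inequality.

  On the primal side, if \<open>DF(xb) h\<close> lies in the affine hull of the cone \<open>N = N\<^sub>Q(lam)\<close>, there is \<open>u\<close> with
  both \<open>DF(xb) u\<close> and \<open>DF(xb)(u + h)\<close> in \<open>N\<close>, and Brouwer's theorem corrects \<open>xb + t u\<close> and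
  \<open>xb + t (u + h)\<close> by \<open>o(t)\<close> to points that \<open>F\<close> maps into \<open>N\<close>. There \<open>\<sigma>\<^sub>Q\<close> is the linear function
  \<open>lam\<close>, so the quotients of \<open>\<phi>\<close> along this path tend to \<open>lam \<bullet> D\<^sup>2F(xb)[h, h]\<close>. Since quotients of
  \<open>\<sigma>\<^sub>Q\<close> are nonnegative, equality follows.
\<close>

section \<open>Uniform first- and second-order expansions\<close>

lemma C_k_on_subset:
  assumes "C_k_on k F U" "V \<subseteq> U"
  shows "C_k_on k F V"
  using assms
proof (induction k arbitrary: F)
  case 0
  then show ?case using continuous_on_subset by auto
next
  case (Suc k)
  then show ?case by (simp add: subset_iff)
qed

lemma C_k_on_differentiable:
  assumes "C_k_on (Suc k) F U" "x \<in> U"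
  shows "(F has_derivative frechet_derivative F (at x)) (at x)"
  using assms by (simp add: frechet_derivative_works)

lemma C_k_on_continuous:
  assumes "C_k_on k F U"
  shows "continuous_on U F"
proof (cases k)
  case 0
  then show ?thesis using assms by simp
next
  case (Suc j)
  then show ?thesis using assms
    by (auto intro!: differentiable_imp_continuous_on differentiable_at_imp_differentiable_on)
qed

lemma C_k_on_1_of_2:
  assumes "C_k_on 2 F U"
  shows "C_k_on 1 F U" and "C_k_on 1 (\<lambda>x. frechet_derivative F (at x) u) U"
proof -
  have "\<forall>x\<in>U. F differentiable (at x)"
    and D: "C_k_on 1 (\<lambda>x. frechet_derivative F (at x) u) U" for u
    using assms by (auto simp: numeral_2_eq_2)
  then show "C_k_on 1 F U"
    using C_k_on_continuous[OF D] by simp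
  show "C_k_on 1 (\<lambda>x. frechet_derivative F (at x) u) U"
    by (rule D)
qed

lemma linear_euclidean_sum:
  fixes f :: "'a::euclidean_space \<Rightarrow> 'b::real_vector"
  assumes "linear f"
  shows "f u = (\<Sum>b\<in>Basis. (u \<bullet> b) *\<^sub>R f b)"
proof -
  have "f u = f (\<Sum>b\<in>Basis. (u \<bullet> b) *\<^sub>R b)"
    by (simp add: euclidean_representation)
  then show ?thesis
    by (simp add: linear_sum[OF assms] linear_scale[OF assms])
qed

lemma norm_sum_Basis_le:
  fixes g :: "'a::euclidean_space \<Rightarrow> 'b::real_normed_vector"
  assumes "\<And>b. b \<in> Basis \<Longrightarrow> norm (g b) \<le> c"
  shows "norm (\<Sum>b\<in>Basis. (u \<bullet> b) *\<^sub>R g b) \<le> real DIM('a) * c * norm u"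
proof -
  have "norm (\<Sum>b\<in>Basis. (u \<bullet> b) *\<^sub>R g b) \<le> (\<Sum>b\<in>(Basis::'a set). norm u * c)"
  proof (rule sum_norm_le)
    fix b :: 'a assume b: "b \<in> Basis"
    show "norm ((u \<bullet> b) *\<^sub>R g b) \<le> norm u * c"
      using mult_mono[OF Basis_le_norm[OF b, of u] assms[OF b]] by simp
  qed
  then show ?thesis by (simp add: mult_ac)
qed

lemma eventually_ball_subset:
  fixes x :: "'a::metric_space"
  assumes "open U" "x \<in> U"
  shows "\<forall>\<^sub>F d in at_right 0. ball x d \<subseteq> U"
proof -
  obtain e where e: "e > 0" "ball x e \<subseteq> U"
    using assms openE by blast
  then have "\<forall>\<^sub>F d in at_right 0. d < e"
    by (intro eventually_at_rightI[of 0 e]) auto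
  then show ?thesis
    by eventually_elim (use e in \<open>auto simp: subset_iff\<close>)
qed

section \<open>Strict differentiability of \<open>F\<close> and of its derivative\<close>

text \<open>\<open>C_k_on\<close> gives continuity of the derivative one direction at a time. Only
  the finitely many basis directions matter, and linearity turns closeness there into a bound
  uniform in \<open>u\<close>. Radii are quantified through \<open>at_right 0\<close>, so that
  finitely many requirements on them can be intersected.\<close>

lemma C1_derivative_close:
  fixes F :: "'a::euclidean_space \<Rightarrow> 'b::euclidean_space"
  assumes C1: "C_k_on 1 F U" and U: "open U" "x0 \<in> U" and e: "e > 0"
  shows "\<forall>\<^sub>F d in at_right 0. ball x0 d \<subseteq> U \<and> (\<forall>x\<in>ball x0 d. \<forall>u.
    norm (frechet_derivative F (at x) u - frechet_derivative F (at x0) u) \<le> e * norm u)"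
proof -
  let ?D = "\<lambda>x. frechet_derivative F (at x)"
  \<comment> \<open>Compensates for the factor \<open>DIM('a)\<close> lost when summing over the
    basis.\<close>
  define c where "c = e / real DIM('a)"
  have c: "c > 0" using e by (simp add: c_def)
  have lin: "linear (?D x)" if "x \<in> U" for x
    using C1 that linear_frechet_derivative by auto
  have "\<forall>\<^sub>F x in nhds x0. \<forall>b\<in>Basis. norm (?D x b - ?D x0 b) < c"
  proof (rule eventually_ball_finite)
    show "\<forall>b\<in>Basis. \<forall>\<^sub>F x in nhds x0. norm (?D x b - ?D x0 b) < c"
    proof
      fix b :: 'a
      have "isCont (\<lambda>x. ?D x b) x0"
        using C1 U by (simp add: continuous_on_eq_continuous_at)
      then have "((\<lambda>x. ?D x b) \<longlongrightarrow> ?D x0 b) (nhds x0)"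
        using tendsto_at_iff_tendsto_nhds[of "\<lambda>x. ?D x b" x0] by (simp add: isCont_def)
      from tendstoD[OF this c] show "\<forall>\<^sub>F x in nhds x0. norm (?D x b - ?D x0 b) < c"
        by (simp add: dist_norm)
    qed
  qed simp
  then obtain S where S: "open S" "x0 \<in> S"
    "\<And>x b. x \<in> S \<Longrightarrow> b \<in> Basis \<Longrightarrow> norm (?D x b - ?D x0 b) < c"
    unfolding eventually_nhds by blast
  have "\<forall>\<^sub>F d in at_right 0. ball x0 d \<subseteq> S \<inter> U"
    using S U by (intro eventually_ball_subset) auto
  then show ?thesis
  proof eventually_elim
    case (elim d)
    have "norm (?D x u - ?D x0 u) \<le> e * norm u" if "x \<in> ball x0 d" for x u
    proof -
      have x: "x \<in> S" "x \<in> U" using that elim by auto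
      have "?D x u - ?D x0 u = (\<Sum>b\<in>Basis. (u \<bullet> b) *\<^sub>R (?D x b - ?D x0 b))"
        unfolding linear_euclidean_sum[OF lin[OF x(2)], of u]
          linear_euclidean_sum[OF lin[OF U(2)], of u]
        by (simp add: scaleR_diff_right sum_subtractf)
      then have "norm (?D x u - ?D x0 u) \<le> real DIM('a) * c * norm u"
        using norm_sum_Basis_le[of "\<lambda>b. ?D x b - ?D x0 b" c u] S(3)[OF x(1)]
        by (simp add: less_imp_le)
      then show ?thesis by (simp add: c_def)
    qed
    then show ?case using elim by auto
  qed
qed

text \<open>The mean value inequality on the convex ball, applied to \<open>F\<close> minus its
  linearisation at \<open>x0\<close>: the derivative of this difference has operator norm at most
  \<open>e\<close> there.\<close>

lemma C1_strictly_differentiable: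
  fixes F :: "'a::euclidean_space \<Rightarrow> 'b::euclidean_space"
  assumes C1: "C_k_on 1 F U" and U: "open U" "x0 \<in> U" and e: "e > 0"
  shows "\<forall>\<^sub>F d in at_right 0. ball x0 d \<subseteq> U \<and> (\<forall>x\<in>ball x0 d. \<forall>y\<in>ball x0 d.
    norm (F y - F x - frechet_derivative F (at x0) (y - x)) \<le> e * norm (y - x))"
  using C1_derivative_close[OF assms] eventually_at_right_less[of 0]
proof eventually_elim
  case (elim d)
  let ?D = "\<lambda>x. frechet_derivative F (at x)"
  have "norm (F y - F x - ?D x0 (y - x)) \<le> norm (y - x) * e"
    if "x \<in> ball x0 d" "y \<in> ball x0 d" for x y
  proof (rule differentiable_bound_linearization)
    show "x + t *\<^sub>R (y - x) \<in> ball x0 d" if "t \<in> {0..1}" for t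
    proof -
      have "(1 - t) *\<^sub>R x + t *\<^sub>R y \<in> ball x0 d"
        using convexD_alt[OF convex_ball \<open>x \<in> _\<close> \<open>y \<in> _\<close>] that by auto
      then show ?thesis by (simp add: algebra_simps)
    qed
    show "(F has_derivative ?D z) (at z within ball x0 d)" if "z \<in> ball x0 d" for z
      using C_k_on_differentiable[OF C1[unfolded One_nat_def], of z] that elim
      by (blast intro: has_derivative_at_withinI)
    show "onorm (?D z - ?D x0) \<le> e" if "z \<in> ball x0 d" for z
      using elim that by (intro onorm_bound) (use e in auto)
    show "x0 \<in> ball x0 d" using elim by simp
  qed
  then show ?case using elim by (auto simp: mult.commute)
qed

text \<open>For each \<open>u\<close>, \<open>second_deriv F x0 u\<close> is the derivative of a
  separate map, so linearity in \<open>u\<close> is not built in. It is inherited from the expansion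
  of \<open>DF(x) u\<close> in the basis, valid near \<open>x0\<close>, by differentiating term by
  term.\<close>

lemma second_deriv_linear_sum:
  fixes F :: "'a::euclidean_space \<Rightarrow> 'b::euclidean_space"
  assumes C2: "C_k_on 2 F U" and U: "open U" "x0 \<in> U"
  shows "second_deriv F x0 u v = (\<Sum>b\<in>Basis. (u \<bullet> b) *\<^sub>R second_deriv F x0 b v)"
proof -
  let ?D = "\<lambda>x. frechet_derivative F (at x)"
  have lin: "linear (?D x)" if "x \<in> U" for x
    using C_k_on_1_of_2(1)[OF C2] that linear_frechet_derivative by auto
  have "((\<lambda>x. \<Sum>b\<in>Basis. (u \<bullet> b) *\<^sub>R ?D x b) has_derivative
      (\<lambda>v. \<Sum>b\<in>Basis. (u \<bullet> b) *\<^sub>R second_deriv F x0 b v)) (at x0)"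
    unfolding second_deriv_def
    using C_k_on_differentiable[OF C_k_on_1_of_2(2)[OF C2, unfolded One_nat_def] U(2)]
    by (intro has_derivative_sum has_derivative_scaleR_right) auto
  then have "((\<lambda>x. ?D x u) has_derivative
      (\<lambda>v. \<Sum>b\<in>Basis. (u \<bullet> b) *\<^sub>R second_deriv F x0 b v)) (at x0)"
    by (rule has_derivative_transform_within_open[OF _ U])
      (simp add: linear_euclidean_sum[OF lin, symmetric])
  from fun_cong[OF frechet_derivative_at[OF this], of v] show ?thesis
    by (simp add: second_deriv_def)
qed

text \<open>Strict differentiability of the maps \<open>DF(x) b\<close> for basis vectors
  \<open>b\<close>, recombined using linearity in \<open>u\<close> of all three terms.\<close>

lemma C2_derivative_strictly_differentiable:
  fixes F :: "'a::euclidean_space \<Rightarrow> 'b::euclidean_space"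
  assumes C2: "C_k_on 2 F U" and U: "open U" "x0 \<in> U" and e: "e > 0"
  shows "\<forall>\<^sub>F d in at_right 0. ball x0 d \<subseteq> U \<and> (\<forall>x\<in>ball x0 d. \<forall>y\<in>ball x0 d. \<forall>u.
    norm (frechet_derivative F (at y) u - frechet_derivative F (at x) u
      - second_deriv F x0 u (y - x)) \<le> e * norm u * norm (y - x))"
proof -
  let ?D = "\<lambda>x. frechet_derivative F (at x)"
  define c where "c = e / real DIM('a)"
  have c: "c > 0" using e by (simp add: c_def)
  have lin: "linear (?D x)" if "x \<in> U" for x
    using C_k_on_1_of_2(1)[OF C2] that linear_frechet_derivative by auto
  have "\<forall>\<^sub>F d in at_right 0. \<forall>b\<in>Basis. ball x0 d \<subseteq> U \<and> (\<forall>x\<in>ball x0 d. \<forall>y\<in>ball x0 d.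
    norm (?D y b - ?D x b - second_deriv F x0 b (y - x)) \<le> c * norm (y - x))"
    using C1_strictly_differentiable[OF C_k_on_1_of_2(2)[OF C2] U c]
    by (intro eventually_ball_finite) (auto simp: second_deriv_def)
  then show ?thesis
  proof eventually_elim
    case (elim d)
    have sub: "ball x0 d \<subseteq> U" using elim nonempty_Basis by blast
    have "norm (?D y u - ?D x u - second_deriv F x0 u (y - x)) \<le> e * norm u * norm (y - x)"
      if "x \<in> ball x0 d" "y \<in> ball x0 d" for x y u
    proof -
      have xy: "x \<in> U" "y \<in> U" using that sub by auto
      have "?D y u - ?D x u - second_deriv F x0 u (y - x) =
          (\<Sum>b\<in>Basis. (u \<bullet> b) *\<^sub>R (?D y b - ?D x b - second_deriv F x0 b (y - x)))"
        unfolding linear_euclidean_sum[OF lin[OF xy(1)], of u]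
          linear_euclidean_sum[OF lin[OF xy(2)], of u] second_deriv_linear_sum[OF C2 U, of u]
        by (simp add: scaleR_diff_right sum_subtractf)
      then have "norm (?D y u - ?D x u - second_deriv F x0 u (y - x))
          \<le> real DIM('a) * (c * norm (y - x)) * norm u"
        using elim that
          norm_sum_Basis_le[of "\<lambda>b. ?D y b - ?D x b - second_deriv F x0 b (y - x)"
            "c * norm (y - x)" u]
        by simp
      then show ?thesis by (simp add: c_def mult_ac)
    qed
    then show ?case using sub by auto
  qed
qed

lemma second_deriv_tendsto:
  fixes F :: "'a::euclidean_space \<Rightarrow> 'b::euclidean_space"
  assumes C2: "C_k_on 2 F U" and U: "open U" "x0 \<in> U"
  shows "((\<lambda>h. second_deriv F x0 h h) \<longlongrightarrow> second_deriv F x0 h0 h0) (nhds h0)"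
proof -
  have "((\<lambda>h. second_deriv F x0 b h) \<longlongrightarrow> second_deriv F x0 b h0) (nhds h0)" for b
  proof -
    have "bounded_linear (second_deriv F x0 b)"
      using C_k_on_differentiable[OF C_k_on_1_of_2(2)[OF C2, unfolded One_nat_def] U(2), of b]
      unfolding second_deriv_def[abs_def] by (rule has_derivative_bounded_linear)
    then show ?thesis
      by (rule bounded_linear.tendsto) (rule filterlim_ident)
  qed
  then have "((\<lambda>h. \<Sum>b\<in>Basis. (h \<bullet> b) *\<^sub>R second_deriv F x0 b h)
      \<longlongrightarrow> (\<Sum>b\<in>Basis. (h0 \<bullet> b) *\<^sub>R second_deriv F x0 b h0)) (nhds h0)"
    by (intro tendsto_intros filterlim_ident)
  then show ?thesis
    by (simp only: second_deriv_linear_sum[OF C2 U, symmetric])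
qed

section \<open>First- and second-order quotients with a moving base point\<close>

text \<open>The expansion is taken at the moving point \<open>x\<close>, while the quadratic form
  stays frozen at \<open>x0\<close>. The function \<open>p\<close> below absorbs both Taylor terms,
  and its derivative is exactly the error controlled by \<open>D\<close>. The mean value theorem
  replaces an integration, hence the factor 2.\<close>

lemma second_order_remainder:
  fixes F :: "'a::euclidean_space \<Rightarrow> 'b::euclidean_space"
  assumes C2: "C_k_on 2 F U" and U: "ball x0 d \<subseteq> U"
    and D: "\<And>x y u. x \<in> ball x0 d \<Longrightarrow> y \<in> ball x0 d \<Longrightarrow>
      norm (frechet_derivative F (at y) u - frechet_derivative F (at x) u
        - second_deriv F x0 u (y - x)) \<le> e * norm u * norm (y - x)"
    and e: "e \<ge> 0" and t: "t > 0" and x: "norm (x - x0) + t * norm h < d"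
  shows "norm ((1 / (t\<^sup>2 / 2)) *\<^sub>R (F (x + t *\<^sub>R h) - F x - t *\<^sub>R frechet_derivative F (at x) h)
      - second_deriv F x0 h h) \<le> 2 * e * (norm h)\<^sup>2"
proof -
  let ?D = "\<lambda>x. frechet_derivative F (at x)"
  let ?S = "second_deriv F x0 h h"
  have C1: "C_k_on 1 F U" using C_k_on_1_of_2[OF C2] by simp
  have in_ball: "x + s *\<^sub>R h \<in> ball x0 d" if "0 \<le> s" "s \<le> t" for s
  proof -
    have "norm (x + s *\<^sub>R h - x0) \<le> norm (x - x0) + norm (s *\<^sub>R h)"
      using norm_triangle_ineq[of "x - x0" "s *\<^sub>R h"] by (simp add: algebra_simps)
    also have "\<dots> \<le> norm (x - x0) + t * norm h"
      using that by (simp add: mult_right_mono)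
    finally show ?thesis using x by (simp add: dist_norm norm_minus_commute)
  qed
  have xb: "x \<in> ball x0 d" using in_ball[of 0] t by simp
  have "x0 \<in> ball x0 d" using xb by (smt (verit) centre_in_ball mem_ball zero_le_dist)
  then have x0: "x0 \<in> U" using U by auto
  have lin: "linear (second_deriv F x0 h)"
    using C_k_on_differentiable[OF C_k_on_1_of_2(2)[OF C2, unfolded One_nat_def] x0, of h]
    unfolding second_deriv_def[abs_def] by (rule has_derivative_linear)
  define p where "p s = F (x + s *\<^sub>R h) - s *\<^sub>R ?D x h - (s\<^sup>2 / 2) *\<^sub>R ?S" for s :: real
  define p' where "p' s = ?D (x + s *\<^sub>R h) h - ?D x h - s *\<^sub>R ?S" for s :: real
  have deriv: "(p has_derivative (\<lambda>r. r *\<^sub>R p' s)) (at s)" if s: "0 \<le> s" "s \<le> t" for s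
  proof -
    have y: "x + s *\<^sub>R h \<in> U" using in_ball[OF s] U by auto
    have linD: "linear (?D (x + s *\<^sub>R h))"
      using C1 y linear_frechet_derivative by auto
    have "((\<lambda>s. F (x + s *\<^sub>R h)) has_derivative (\<lambda>r. ?D (x + s *\<^sub>R h) (r *\<^sub>R h))) (at s)"
      using C1 y
      by (intro has_derivative_compose[of "\<lambda>s. x + s *\<^sub>R h" "\<lambda>r. r *\<^sub>R h" s UNIV F,
            OF _ C_k_on_differentiable[of 0 F U]])
        (auto intro!: derivative_eq_intros)
    then have "(p has_derivative
        (\<lambda>r. ?D (x + s *\<^sub>R h) (r *\<^sub>R h) - r *\<^sub>R ?D x h - (s * r) *\<^sub>R ?S)) (at s)"
      unfolding p_def by (auto intro!: derivative_eq_intros)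
    then show ?thesis
      by (simp add: p'_def linear_scale[OF linD] scaleR_diff_right mult.commute)
  qed
  have "\<exists>s\<in>{0<..<t}. norm (p t - p 0) \<le> norm ((t - 0) *\<^sub>R p' s)"
  proof (rule mvt_general)
    show "continuous_on {0..t} p"
      using deriv
      by (intro has_derivative_continuous_on[of _ _ "\<lambda>s r. r *\<^sub>R p' s"])
        (auto intro: has_derivative_at_withinI)
  qed (use t deriv in auto)
  then obtain s where s: "0 < s" "s < t" "norm (p t - p 0) \<le> t * norm (p' s)"
    using t by auto
  have "norm (p' s) \<le> e * norm h * norm (s *\<^sub>R h)"
    using D[OF xb in_ball[of s], of h] s by (simp add: p'_def linear_scale[OF lin])
  also have "\<dots> = s * (e * norm h * norm h)" using s by simp
  also have "\<dots> \<le> t * (e * norm h * norm h)" using s e by (intro mult_right_mono) auto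
  finally have "t * norm (p' s) \<le> t * (t * (e * norm h * norm h))"
    using t by (intro mult_left_mono) auto
  then have le: "norm (p t - p 0) \<le> t\<^sup>2 * e * (norm h)\<^sup>2"
    using s(3) by (simp add: power2_eq_square mult_ac)
  have "(1 / (t\<^sup>2 / 2)) *\<^sub>R (F (x + t *\<^sub>R h) - F x - t *\<^sub>R ?D x h) - ?S
      = (2 / t\<^sup>2) *\<^sub>R (p t - p 0)"
    using t by (simp add: p_def scaleR_diff_right)
  also have "norm \<dots> = (2 / t\<^sup>2) * norm (p t - p 0)" by simp
  also have "\<dots> \<le> (2 / t\<^sup>2) * (t\<^sup>2 * e * (norm h)\<^sup>2)"
    using le by (intro mult_left_mono) auto
  also have "\<dots> = 2 * e * (norm h)\<^sup>2" using t by simp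
  finally show ?thesis .
qed

text \<open>The limit is joint in step, direction and base point because the strict second
  subderivative lets all of them vary.\<close>

lemma second_order_quotient_tendsto:
  fixes F :: "'a::euclidean_space \<Rightarrow> 'b::euclidean_space"
  assumes C2: "C_k_on 2 F U" and U: "open U" "x0 \<in> U"
  shows "((\<lambda>(t, h, x). (1 / (t\<^sup>2 / 2)) *\<^sub>R
        (F (x + t *\<^sub>R h) - F x - t *\<^sub>R frechet_derivative F (at x) h))
      \<longlongrightarrow> second_deriv F x0 h0 h0) (at_right 0 \<times>\<^sub>F nhds h0 \<times>\<^sub>F nhds x0)"
proof (rule tendstoI)
  fix \<epsilon> :: real assume \<epsilon>: "\<epsilon> > 0"
  \<comment> \<open>A bound for the norm of all directions close to \<open>h0\<close>.\<close>
  define M where "M = norm h0 + 1"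
  have M: "M > 0" by (simp add: M_def add_nonneg_pos)
  \<comment> \<open>The remainder bound \<open>2 * e * M\<^sup>2\<close> becomes
    \<open>\<epsilon> / 2\<close>.\<close>
  define e where "e = \<epsilon> / (4 * M\<^sup>2)"
  have e: "e > 0" using \<epsilon> M by (simp add: e_def)
  obtain d where d: "d > 0" "ball x0 d \<subseteq> U"
    and D: "\<And>x y u. x \<in> ball x0 d \<Longrightarrow> y \<in> ball x0 d \<Longrightarrow>
      norm (frechet_derivative F (at y) u - frechet_derivative F (at x) u
        - second_deriv F x0 u (y - x)) \<le> e * norm u * norm (y - x)"
    using eventually_happens[OF eventually_conj[OF eventually_at_right_less[of 0]
          C2_derivative_strictly_differentiable[OF C2 U e]]] by auto
  \<comment> \<open>Half of the radius \<open>d\<close> is reserved for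
    \<open>t *\<^sub>R h\<close>, the other half for \<open>x - x0\<close>.\<close>
  have "\<forall>\<^sub>F t in at_right 0. 0 < t \<and> t < d / (2 * M)"
    using d M by (intro eventually_at_rightI[of 0 "d / (2 * M)"]) auto
  moreover have "\<forall>\<^sub>F h in nhds h0. dist (second_deriv F x0 h h) (second_deriv F x0 h0 h0) < \<epsilon> / 2
      \<and> norm h < M"
    using tendstoD[OF second_deriv_tendsto[OF C2 U, of h0], of "\<epsilon> / 2"] \<epsilon>
      order_tendstoD(2)[OF tendsto_norm[OF filterlim_ident[of "nhds h0"]], of M]
    by (intro eventually_conj) (auto simp: M_def)
  moreover have "\<forall>\<^sub>F x in nhds x0. norm (x - x0) < d / 2"
    using d by (auto simp: eventually_nhds_metric dist_norm intro!: exI[of _ "d / 2"])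
  ultimately have "\<forall>\<^sub>F p in at_right 0 \<times>\<^sub>F nhds h0 \<times>\<^sub>F nhds x0.
      (0 < fst p \<and> fst p < d / (2 * M)) \<and>
      (dist (second_deriv F x0 (fst (snd p)) (fst (snd p))) (second_deriv F x0 h0 h0) < \<epsilon> / 2
        \<and> norm (fst (snd p)) < M) \<and> norm (snd (snd p) - x0) < d / 2"
    by (intro eventually_prodI)
  then show "\<forall>\<^sub>F p in at_right 0 \<times>\<^sub>F nhds h0 \<times>\<^sub>F nhds x0.
      dist (case p of (t, h, x) \<Rightarrow> (1 / (t\<^sup>2 / 2)) *\<^sub>R
        (F (x + t *\<^sub>R h) - F x - t *\<^sub>R frechet_derivative F (at x) h))
        (second_deriv F x0 h0 h0) < \<epsilon>"
  proof eventually_elim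
    case (elim p)
    obtain t h x where p: "p = (t, h, x)" by (cases p)
    have th: "0 < t" "t < d / (2 * M)" "norm h < M" "norm (x - x0) < d / 2"
      "dist (second_deriv F x0 h h) (second_deriv F x0 h0 h0) < \<epsilon> / 2"
      using elim by (auto simp: p)
    have "t * norm h \<le> d / (2 * M) * M"
      using th by (intro mult_mono) auto
    then have "norm (x - x0) + t * norm h < d" using th M by simp
    from second_order_remainder[OF C2 d(2) D less_imp_le[OF e] th(1) this]
    have "norm ((1 / (t\<^sup>2 / 2)) *\<^sub>R (F (x + t *\<^sub>R h) - F x - t *\<^sub>R frechet_derivative F (at x) h)
      - second_deriv F x0 h h) \<le> 2 * e * (norm h)\<^sup>2" .
    also have "\<dots> \<le> 2 * e * M\<^sup>2"
      using th e by (intro mult_left_mono power_mono) auto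
    also have "\<dots> = \<epsilon> / 2" using M by (simp add: e_def)
    finally have "dist ((1 / (t\<^sup>2 / 2)) *\<^sub>R
        (F (x + t *\<^sub>R h) - F x - t *\<^sub>R frechet_derivative F (at x) h))
        (second_deriv F x0 h h) \<le> \<epsilon> / 2" by (simp add: dist_norm)
    with th(5) have "dist ((1 / (t\<^sup>2 / 2)) *\<^sub>R
        (F (x + t *\<^sub>R h) - F x - t *\<^sub>R frechet_derivative F (at x) h))
        (second_deriv F x0 h0 h0) < \<epsilon>"
      using dist_triangle[of _ "second_deriv F x0 h0 h0" "second_deriv F x0 h h"]
      by (smt (verit) field_sum_of_halves)
    then show ?case by (simp add: p)
  qed
qed

text \<open>Strict differentiability at \<open>x0\<close> allows the base point to move. The limit
  identifies the direction in which the increments of \<open>F\<close> are fed to the support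
  function.\<close>

lemma difference_quotient_tendsto:
  fixes F :: "'a::euclidean_space \<Rightarrow> 'b::euclidean_space"
  assumes C1: "C_k_on 1 F U" and U: "open U" "x0 \<in> U"
  shows "((\<lambda>(t, h, x). (1 / t) *\<^sub>R (F (x + t *\<^sub>R h) - F x))
      \<longlongrightarrow> frechet_derivative F (at x0) h0) (at_right 0 \<times>\<^sub>F nhds h0 \<times>\<^sub>F nhds x0)"
proof (rule tendstoI)
  let ?D = "frechet_derivative F (at x0)"
  fix \<epsilon> :: real assume \<epsilon>: "\<epsilon> > 0"
  define M where "M = norm h0 + 1"
  have M: "M > 0" by (simp add: M_def add_nonneg_pos)
  define e where "e = \<epsilon> / (2 * M)"
  have e: "e > 0" using \<epsilon> M by (simp add: e_def)
  have D: "(F has_derivative ?D) (at x0)"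
    using C_k_on_differentiable[OF C1[unfolded One_nat_def] U(2)] .
  obtain d where d: "d > 0"
    and F: "\<And>x y. x \<in> ball x0 d \<Longrightarrow> y \<in> ball x0 d \<Longrightarrow>
      norm (F y - F x - ?D (y - x)) \<le> e * norm (y - x)"
    using eventually_happens[OF eventually_conj[OF eventually_at_right_less[of 0]
          C1_strictly_differentiable[OF C1 U e]]] by auto
  have "\<forall>\<^sub>F t in at_right 0. 0 < t \<and> t < d / (2 * M)"
    using d M by (intro eventually_at_rightI[of 0 "d / (2 * M)"]) auto
  moreover have "\<forall>\<^sub>F h in nhds h0. dist (?D h) (?D h0) < \<epsilon> / 2 \<and> norm h < M"
    using tendstoD[OF bounded_linear.tendsto[OF has_derivative_bounded_linear[OF D]
          filterlim_ident[of "nhds h0"]], of "\<epsilon> / 2"] \<epsilon>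
      order_tendstoD(2)[OF tendsto_norm[OF filterlim_ident[of "nhds h0"]], of M]
    by (intro eventually_conj) (auto simp: M_def)
  moreover have "\<forall>\<^sub>F x in nhds x0. norm (x - x0) < d / 2"
    using d by (auto simp: eventually_nhds_metric dist_norm intro!: exI[of _ "d / 2"])
  ultimately have "\<forall>\<^sub>F p in at_right 0 \<times>\<^sub>F nhds h0 \<times>\<^sub>F nhds x0.
      (0 < fst p \<and> fst p < d / (2 * M)) \<and>
      (dist (?D (fst (snd p))) (?D h0) < \<epsilon> / 2 \<and> norm (fst (snd p)) < M)
      \<and> norm (snd (snd p) - x0) < d / 2"
    by (intro eventually_prodI)
  then show "\<forall>\<^sub>F p in at_right 0 \<times>\<^sub>F nhds h0 \<times>\<^sub>F nhds x0.
      dist (case p of (t, h, x) \<Rightarrow> (1 / t) *\<^sub>R (F (x + t *\<^sub>R h) - F x)) (?D h0) < \<epsilon>"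
  proof eventually_elim
    case (elim p)
    obtain t h x where p: "p = (t, h, x)" by (cases p)
    have th: "0 < t" "t < d / (2 * M)" "norm h < M" "norm (x - x0) < d / 2"
      "dist (?D h) (?D h0) < \<epsilon> / 2"
      using elim by (auto simp: p)
    have "t * norm h \<le> d / (2 * M) * M"
      using th by (intro mult_mono) auto
    then have le: "t * norm h \<le> d / 2" using M by simp
    have "norm (x + t *\<^sub>R h - x0) \<le> norm (x - x0) + norm (t *\<^sub>R h)"
      using norm_triangle_ineq[of "x - x0" "t *\<^sub>R h"] by (simp add: algebra_simps)
    then have "x + t *\<^sub>R h \<in> ball x0 d" "x \<in> ball x0 d"
      using le th d by (auto simp: dist_norm norm_minus_commute[of x0])
    from F[OF this(2,1)] have *: "norm (F (x + t *\<^sub>R h) - F x - t *\<^sub>R ?D h) \<le> e * (t * norm h)"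
      using th(1) by (simp add: linear_scale[OF has_derivative_linear[OF D]])
    have "(1 / t) *\<^sub>R (F (x + t *\<^sub>R h) - F x) - ?D h
        = (1 / t) *\<^sub>R (F (x + t *\<^sub>R h) - F x - t *\<^sub>R ?D h)"
      using th(1) by (simp add: scaleR_diff_right)
    also have "norm \<dots> = (1 / t) * norm (F (x + t *\<^sub>R h) - F x - t *\<^sub>R ?D h)"
      using th(1) by simp
    also have "\<dots> \<le> (1 / t) * (e * (t * norm h))"
      using * th(1) by (intro mult_left_mono) auto
    also have "\<dots> \<le> e * M" using th e by simp
    also have "\<dots> = \<epsilon> / 2" using M by (simp add: e_def)
    finally have "dist ((1 / t) *\<^sub>R (F (x + t *\<^sub>R h) - F x)) (?D h) \<le> \<epsilon> / 2"
      by (simp add: dist_norm)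
    with th(5) have "dist ((1 / t) *\<^sub>R (F (x + t *\<^sub>R h) - F x)) (?D h0) < \<epsilon>"
      using dist_triangle[of "(1 / t) *\<^sub>R (F (x + t *\<^sub>R h) - F x)" "?D h0" "?D h"] by linarith
    then show ?case by (simp add: p)
  qed
qed

section \<open>Convex cones and tangent paths\<close>

lemma convex_cone_sum:
  assumes "convex_cone N" "\<And>i. i \<in> I \<Longrightarrow> f i \<in> N"
  shows "sum f I \<in> N"
  using assms(2)
proof (induction I rule: infinite_finite_induct)
  case (insert i I)
  then show ?case using assms(1) by (simp add: convex_cone_add)
qed (use assms(1) in \<open>auto simp: convex_cone_iff\<close>)

text \<open>Solutions are chosen only at the vectors \<open>b\<close> and \<open>- b\<close> of the
  basis and combined with the positive and negative parts of the coordinates of \<open>y\<close>.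
  These coefficients are continuous and nonnegative, so the combination is continuous, grows
  linearly, and keeps the second component in the cone.\<close>

lemma convex_cone_right_inverse:
  fixes A :: "'a::euclidean_space \<Rightarrow> 'b::euclidean_space"
  assumes A: "linear A" and N: "convex_cone N"
    and surj: "{A u - w | u w. w \<in> N} = UNIV"
  obtains s n C where "continuous_on UNIV s" "continuous_on UNIV n" "C > 0"
    "\<And>y. n y \<in> N" "\<And>y. A (s y) - n y = y" "\<And>y. norm (s y) \<le> C * norm y"
proof -
  have "\<exists>u w. w \<in> N \<and> A u - w = z" for z
  proof -
    have "z \<in> {A u - w | u w. w \<in> N}" unfolding surj by simp
    then show ?thesis by blast
  qed
  then obtain a w where w: "\<And>z. w z \<in> N" and aw: "\<And>z. A (a z) - w z = z"
    by metis
  define La where "La y = (\<Sum>b\<in>Basis. max 0 (y \<bullet> b) *\<^sub>R a b + max 0 (- (y \<bullet> b)) *\<^sub>R a (- b))" for y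
  define Lw where "Lw y = (\<Sum>b\<in>Basis. max 0 (y \<bullet> b) *\<^sub>R w b + max 0 (- (y \<bullet> b)) *\<^sub>R w (- b))" for y
  define C where "C = (\<Sum>b\<in>(Basis::'b set). norm (a b) + norm (a (- b))) + 1"
  show ?thesis
  proof
    show "continuous_on UNIV La" "continuous_on UNIV Lw"
      unfolding La_def Lw_def by (intro continuous_intros)+
    show "C > 0" unfolding C_def by (simp add: add_nonneg_pos sum_nonneg)
    show "Lw y \<in> N" for y
      unfolding Lw_def using N w
      by (intro convex_cone_sum convex_cone_add convex_cone_scaleR) auto
    show "A (La y) - Lw y = y" for y
    proof -
      have "A (La y) - Lw y = (\<Sum>b\<in>Basis. max 0 (y \<bullet> b) *\<^sub>R (A (a b) - w b)
          + max 0 (- (y \<bullet> b)) *\<^sub>R (A (a (- b)) - w (- b)))"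
        by (simp add: La_def Lw_def linear_sum[OF A] linear_add[OF A] linear_scale[OF A]
            algebra_simps flip: sum_subtractf sum.distrib)
      also have "\<dots> = (\<Sum>b\<in>Basis. (y \<bullet> b) *\<^sub>R b)"
        unfolding aw by (intro sum.cong) (auto simp: max_def)
      finally show ?thesis by (simp add: euclidean_representation)
    qed
    show "norm (La y) \<le> C * norm y" for y
    proof -
      have "norm (La y) \<le> (\<Sum>b\<in>(Basis::'b set). (norm (a b) + norm (a (- b))) * norm y)"
        unfolding La_def
      proof (rule sum_norm_le)
        fix b :: 'b assume b: "b \<in> Basis"
        have m: "max 0 (y \<bullet> b) \<le> norm y" "max 0 (- (y \<bullet> b)) \<le> norm y"
          using Basis_le_norm[OF b, of y] by auto
        show "norm (max 0 (y \<bullet> b) *\<^sub>R a b + max 0 (- (y \<bullet> b)) *\<^sub>R a (- b))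
            \<le> (norm (a b) + norm (a (- b))) * norm y"
          using mult_right_mono[OF m(1), of "norm (a b)"] mult_right_mono[OF m(2), of "norm (a (- b))"]
          by (intro norm_triangle_le) (simp add: algebra_simps)
      qed
      also have "\<dots> = (C - 1) * norm y"
        by (simp add: C_def sum_distrib_right)
      also have "\<dots> \<le> C * norm y"
        by (intro mult_right_mono) auto
      finally show ?thesis .
    qed
  qed
qed

text \<open>A Lyusternik-type correction: \<open>xb + t *\<^sub>R u\<close> is mapped into
  \<open>N\<close> up to an error \<open>o(t)\<close>, which the bounded right inverse removes by a
  change of size \<open>o(t)\<close>. Brouwer's theorem suffices because the right inverse is
  continuous.\<close>

lemma cone_tangent_path:
  fixes F :: "'a::euclidean_space \<Rightarrow> 'b::euclidean_space"
  assumes F: "continuous_on U F" "(F has_derivative A) (at xb)" "F xb = 0"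
    and U: "open U" "xb \<in> U" and N: "convex_cone N"
    and surj: "{A u - w | u w. w \<in> N} = UNIV" and u: "A u \<in> N"
  obtains p :: "real \<Rightarrow> 'a" where "(p \<longlongrightarrow> u) (at_right 0)"
    "\<forall>\<^sub>F t in at_right 0. F (xb + t *\<^sub>R p t) \<in> N"
proof -
  have A: "linear A" using F(2) by (rule has_derivative_linear)
  obtain s n C where cont: "continuous_on UNIV s" "continuous_on UNIV n" and C: "C > 0"
    and n: "\<And>y. n y \<in> N"
    and sn: "\<And>y. A (s y) - n y = y" and s: "\<And>y. norm (s y) \<le> C * norm y"
    using convex_cone_right_inverse[OF A N surj] by metis
  have near: "\<forall>\<^sub>F t in at_right 0. \<exists>w. dist w u \<le> C * \<epsilon> \<and> F (xb + t *\<^sub>R w) \<in> N"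
    if \<epsilon>: "\<epsilon> > 0" for \<epsilon>
  proof -
    \<comment> \<open>\<open>t * M\<close> bounds the displacement \<open>x y\<close> on the ball
      \<open>B\<close>, so first-order accuracy \<open>\<epsilon> / M\<close> gives an error of at
      most \<open>\<epsilon> * t\<close>, the radius of \<open>B\<close>.\<close>
    define M where "M = norm u + C * \<epsilon>"
    have M: "M > 0" using C \<epsilon> by (simp add: M_def add_nonneg_pos)
    obtain d0 where d0: "d0 > 0" "ball xb d0 \<subseteq> U" using U openE by blast
    have "\<epsilon> / M > 0" using \<epsilon> M by simp
    then obtain d1 where d1: "d1 > 0"
      "\<And>y. norm (y - xb) < d1 \<Longrightarrow> norm (F y - F xb - A (y - xb)) \<le> \<epsilon> / M * norm (y - xb)"
      using F(2) unfolding has_derivative_at_alt by blast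
    define d where "d = min d0 d1"
    have d: "d > 0" "d \<le> d0" "d \<le> d1" using d0 d1 by (auto simp: d_def)
    have "\<forall>\<^sub>F t in at_right 0. 0 < t \<and> t < d / M"
      using d M by (intro eventually_at_rightI[of 0 "d / M"]) auto
    then show ?thesis
    proof eventually_elim
      case (elim t)
      define B where "B = cball (0::'b) (\<epsilon> * t)"
      define x where "x y = t *\<^sub>R u + s y" for y
      \<comment> \<open>A fixed point \<open>y\<close> satisfies
        \<open>F (xb + x y) = A (x y) - y\<close>. By the choice of \<open>s\<close> this is
        \<open>t *\<^sub>R A u + n y\<close>, a sum of two elements of the cone.\<close>
      define f where "f y = A (x y) - F (xb + x y)" for y
      have xy: "norm (x y) \<le> t * M" if "y \<in> B" for y
      proof -
        have "norm (x y) \<le> t * norm u + C * norm y"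
          using s[of y] elim by (auto simp: x_def intro!: norm_triangle_le)
        also have "\<dots> \<le> t * norm u + C * (\<epsilon> * t)" using that C by (simp add: B_def)
        finally show ?thesis by (simp add: M_def algebra_simps)
      qed
      have tM: "t * M < d" using elim M by (simp add: field_simps)
      have inU: "xb + x y \<in> U" if "y \<in> B" for y
        using xy[OF that] tM d d0 by (auto simp: subset_iff dist_norm)
      obtain y where y: "y \<in> B" "f y = y"
      proof (rule brouwer[of B f])
        have "0 \<le> \<epsilon> * t" using elim \<epsilon> by simp
        then show "compact B" "convex B" "B \<noteq> {}" by (auto simp: B_def)
        have cx: "continuous_on B (\<lambda>y. x y)"
          unfolding x_def using continuous_on_subset[OF cont(1)] by (intro continuous_intros) auto
        show "continuous_on B f"
          unfolding f_def
        proof (intro continuous_on_diff)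
          show "continuous_on B (\<lambda>y. A (x y))"
            using linear_continuous_on_compose[OF cx A] .
          show "continuous_on B (\<lambda>y. F (xb + x y))"
            by (rule continuous_on_compose2[OF F(1)]) (use cx inU in \<open>auto intro!: continuous_intros\<close>)
        qed
        show "f \<in> B \<rightarrow> B"
        proof
          fix y assume y: "y \<in> B"
          have "norm (f y) = norm (F (xb + x y) - F xb - A (x y))"
            by (simp add: f_def F(3) norm_minus_commute)
          also have "\<dots> \<le> \<epsilon> / M * norm (x y)"
            using d1(2)[of "xb + x y"] xy[OF y] tM d by simp
          also have "\<dots> \<le> \<epsilon> / M * (t * M)"
            using xy[OF y] \<epsilon> M by (intro mult_left_mono) auto
          finally show "f y \<in> B" using M by (simp add: B_def)
        qed
      qed
      have "F (xb + x y) = A (x y) - y" using y(2) by (simp add: f_def algebra_simps)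
      also have "\<dots> = t *\<^sub>R A u + n y"
        using sn[of y] by (simp add: x_def linear_add[OF A] linear_scale[OF A] algebra_simps)
      also have "\<dots> \<in> N" using N u n elim by (intro convex_cone_add convex_cone_scaleR) auto
      finally have mem: "F (xb + x y) \<in> N" .
      have eq: "x y = t *\<^sub>R (u + (1 / t) *\<^sub>R s y)" using elim by (simp add: x_def scaleR_add_right)
      have "dist (u + (1 / t) *\<^sub>R s y) u = (1 / t) * norm (s y)" using elim by (simp add: dist_norm)
      also have "\<dots> \<le> (1 / t) * (C * (\<epsilon> * t))"
        using s[of y] y(1) C elim
        by (intro mult_left_mono order_trans[OF s]) (auto simp: B_def)
      finally have "dist (u + (1 / t) *\<^sub>R s y) u \<le> C * \<epsilon>" using elim by simp
      with mem show ?case unfolding eq by blast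
    qed
  qed
  \<comment> \<open>The corrections above depend on \<open>\<epsilon>\<close>. A single path is
    obtained by choosing, for each \<open>t\<close>, an admissible direction that is nearest to
    \<open>u\<close> up to the slack \<open>t\<close>.\<close>
  define S where "S t = {w. F (xb + t *\<^sub>R w) \<in> N}" for t
  have S_ne: "\<forall>\<^sub>F t in at_right 0. S t \<noteq> {}"
    using near[of 1] by (auto elim!: eventually_mono simp: S_def)
  have "\<exists>w. S t \<noteq> {} \<longrightarrow> w \<in> S t \<and> dist u w \<le> infdist u (S t) + t" if "t > 0" for t
    using cInf_lessD[of "dist u ` S t" "infdist u (S t) + t"] that
    by (force simp: infdist_notempty)
  then obtain p where p: "\<And>t. t > 0 \<Longrightarrow> S t \<noteq> {} \<Longrightarrow> p t \<in> S t \<and> dist u (p t) \<le> infdist u (S t) + t"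
    by metis
  show ?thesis
  proof
    show "\<forall>\<^sub>F t in at_right 0. F (xb + t *\<^sub>R p t) \<in> N"
      using S_ne eventually_at_right_less[of 0]
      by eventually_elim (use p in \<open>auto simp: S_def\<close>)
    show "(p \<longlongrightarrow> u) (at_right 0)"
    proof (rule tendstoI)
      fix e :: real assume e: "e > 0"
      have "\<forall>\<^sub>F t in at_right 0. t < e / 2"
        using e by (intro eventually_at_rightI[of 0 "e / 2"]) auto
      \<comment> \<open>With this accuracy the distance from \<open>u\<close> to \<open>S t\<close>
        is at most \<open>e / 4\<close>; the slack adds less than \<open>e / 2\<close>.\<close>
      moreover have "e / (4 * C) > 0" using e C by simp
      note near[OF this]
      ultimately show "\<forall>\<^sub>F t in at_right 0. dist (p t) u < e"
        using S_ne eventually_at_right_less[of 0]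
      proof eventually_elim
        case (elim t)
        then obtain w where w: "w \<in> S t" "dist w u \<le> e / 4" using C by (auto simp: S_def)
        then have "infdist u (S t) \<le> e / 4" by (metis dist_commute infdist_le2)
        then show ?case using p[of t] elim e by (auto simp: dist_commute)
      qed
    qed
  qed
qed

text \<open>The differences of elements of a convex cone form a subspace, and it contains the cone
  since 0 lies in it. A negative scalar exchanges the two elements.\<close>

lemma affine_hull_convex_cone_subset:
  assumes N: "convex_cone N"
  shows "affine hull N \<subseteq> {w - w' | w w'. w \<in> N \<and> w' \<in> N}" (is "_ \<subseteq> ?V")
proof (rule hull_minimal)
  have N0: "0 \<in> N" using N by (simp add: convex_cone_iff)
  then show "N \<subseteq> ?V" by force
  have "subspace ?V"
    unfolding subspace_def
  proof (intro conjI ballI allI)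
    show "0 \<in> ?V" using N0 by force
  next
    fix a b assume "a \<in> ?V" "b \<in> ?V"
    then obtain w1 w2 w3 w4 where w: "a = w1 - w2" "b = w3 - w4" "w1 \<in> N" "w2 \<in> N" "w3 \<in> N" "w4 \<in> N"
      by auto
    have "a + b = (w1 + w3) - (w2 + w4)" using w by simp
    then show "a + b \<in> ?V" using w convex_cone_add[OF N] by blast
  next
    fix c :: real and a assume "a \<in> ?V"
    then obtain w1 w2 where w: "a = w1 - w2" "w1 \<in> N" "w2 \<in> N" by auto
    show "c *\<^sub>R a \<in> ?V"
    proof (cases "c \<ge> 0")
      case True
      then show ?thesis using w convex_cone_scaleR[OF N] by (auto simp: scaleR_diff_right)
    next
      case False
      have "c *\<^sub>R a = (- c) *\<^sub>R w2 - (- c) *\<^sub>R w1" using w by (simp add: scaleR_diff_right)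
      moreover have "(- c) *\<^sub>R w2 \<in> N" "(- c) *\<^sub>R w1 \<in> N"
        using w False by (intro convex_cone_scaleR[OF N]; simp)+
      ultimately show ?thesis by blast
    qed
  qed
  then show "affine ?V" by (rule subspace_imp_affine)
qed

section \<open>Multipliers and the chain rule\<close>

lemma normal_cone_mem_iff:
  "w \<in> normal_cone Q q \<longleftrightarrow> q \<in> Q \<and> (\<forall>q'\<in>Q. q' \<bullet> w \<le> q \<bullet> w)"
  by (auto simp: normal_cone_def inner_diff_right inner_commute)

lemma convex_cone_normal_cone:
  assumes "q \<in> Q"
  shows "convex_cone (normal_cone Q q)"
  using assms
  by (auto simp: convex_cone_iff normal_cone_mem_iff inner_add_right intro: add_mono mult_left_mono)

lemma support_fun_le_iff: "support_fun Q z \<le> ereal a \<longleftrightarrow> (\<forall>q\<in>Q. q \<bullet> z \<le> a)"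
  by (auto simp: support_fun_def SUP_le_iff)

lemma support_fun_ge: "q \<in> Q \<Longrightarrow> ereal (q \<bullet> z) \<le> support_fun Q z"
  by (auto simp: support_fun_def intro: SUP_upper)

text \<open>Normality of \<open>z\<close> at \<open>q\<close> means that \<open>q\<close> attains
  the supremum. Hence \<open>support_fun Q\<close> is linear on the whole cone of normals at
  \<open>q\<close>, with gradient \<open>q\<close>.\<close>

lemma support_fun_normal_cone:
  assumes "z \<in> normal_cone Q q"
  shows "support_fun Q z = ereal (q \<bullet> z)"
  using assms by (intro antisym) (auto simp: normal_cone_mem_iff support_fun_le_iff support_fun_ge)

text \<open>Testing the qualification condition \<open>DF(xb)\<real>\<^sup>n - N\<^sub>Q(lam) = \<real>\<^sup>m\<close> at \<open>lam - q\<close> turns it into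
  an error bound, which makes multipliers near \<open>xb\<close> bounded and forces them to converge to \<open>lam\<close>.\<close>

lemma multiplier_error_bound:
  fixes F :: "'a::euclidean_space \<Rightarrow> 'b::euclidean_space"
  assumes C1: "C_k_on 1 F U" and U: "open U" "xb \<in> U" and lam: "lam \<in> Q"
    and surj: "{frechet_derivative F (at xb) u - w | u w. w \<in> normal_cone Q lam} = UNIV"
  obtains \<kappa> where "\<kappa> > 0" "\<forall>\<^sub>F d in at_right 0. ball xb d \<subseteq> U \<and> (\<forall>x\<in>ball xb d. \<forall>q\<in>Q.
    norm (q - lam) \<le> \<kappa> * norm (adjoint (frechet_derivative F (at x)) (q - lam)))"
proof -
  let ?D = "\<lambda>x. frechet_derivative F (at x)"
  have lin: "linear (?D x)" if "x \<in> U" for x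
    using C1 that linear_frechet_derivative by auto
  obtain s n C where C: "C > 0" and n: "\<And>y. n y \<in> normal_cone Q lam"
    and sn: "\<And>y. ?D xb (s y) - n y = y" and s: "\<And>y. norm (s y) \<le> C * norm y"
    using convex_cone_right_inverse[OF lin[OF U(2)] convex_cone_normal_cone[OF lam] surj] by metis
  \<comment> \<open>Replacing \<open>DF(xb)\<close> by \<open>DF(x)\<close> then costs at most half
    of the squared norm of \<open>q - lam\<close>, which is absorbed on the left and produces the
    constant \<open>2 * C\<close>.\<close>
  have e: "1 / (2 * C) > 0" using C by simp
  show ?thesis
  proof
    show "2 * C > 0" using C by simp
    show "\<forall>\<^sub>F d in at_right 0. ball xb d \<subseteq> U \<and> (\<forall>x\<in>ball xb d. \<forall>q\<in>Q.
        norm (q - lam) \<le> 2 * C * norm (adjoint (?D x) (q - lam)))"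
      using C1_derivative_close[OF C1 U e]
    proof eventually_elim
      case (elim d)
      have "norm (q - lam) \<le> 2 * C * norm (adjoint (?D x) (q - lam))"
        if x: "x \<in> ball xb d" and q: "q \<in> Q" for x q
      proof (cases "q = lam")
        case False
        define \<mu> where "\<mu> = q - lam"
        \<comment> \<open>This \<open>y\<close> solves
          \<open>DF(xb) y - n (- \<mu>) = - \<mu>\<close>; pairing with \<open>\<mu>\<close>
          expresses its squared norm through \<open>DF(xb) y\<close> and a normal vector whose
          contribution has a sign.\<close>
        define y where "y = s (- \<mu>)"
        have \<mu>: "norm \<mu> > 0" using False by (simp add: \<mu>_def)
        have y: "norm y \<le> C * norm \<mu>" using s[of "- \<mu>"] by (simp add: y_def)
        have "\<mu> \<bullet> n (- \<mu>) \<le> 0"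
          using n[of "- \<mu>"] q by (auto simp: normal_cone_mem_iff \<mu>_def inner_diff_left)
        moreover have "\<mu> \<bullet> \<mu> = \<mu> \<bullet> n (- \<mu>) - \<mu> \<bullet> ?D xb y"
          using arg_cong[OF sn[of "- \<mu>"], of "inner \<mu>"] by (simp add: y_def inner_diff_right)
        moreover have "- (\<mu> \<bullet> ?D xb y) = \<mu> \<bullet> (?D x y - ?D xb y) - adjoint (?D x) \<mu> \<bullet> y"
          using adjoint_clauses(2)[OF lin[of x], of \<mu> y] x elim by (auto simp: inner_diff_right)
        moreover have "\<mu> \<bullet> (?D x y - ?D xb y) \<le> norm \<mu> * (1 / (2 * C) * (C * norm \<mu>))"
        proof -
          have "norm (?D x y - ?D xb y) \<le> 1 / (2 * C) * norm y" using elim x by blast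
          also have "\<dots> \<le> 1 / (2 * C) * (C * norm \<mu>)" using y e by (intro mult_left_mono) auto
          finally show ?thesis
            by (meson mult_left_mono norm_cauchy_schwarz norm_ge_zero order_trans)
        qed
        moreover have "- (adjoint (?D x) \<mu> \<bullet> y) \<le> norm (adjoint (?D x) \<mu>) * (C * norm \<mu>)"
          using norm_cauchy_schwarz[of "- adjoint (?D x) \<mu>" y]
            mult_left_mono[OF y norm_ge_zero[of "adjoint (?D x) \<mu>"]] by simp
        ultimately have "\<mu> \<bullet> \<mu> \<le> norm \<mu> * norm \<mu> / 2 + C * norm (adjoint (?D x) \<mu>) * norm \<mu>"
          using C by (simp add: mult_ac)
        then have "norm \<mu> * norm \<mu> \<le> (2 * C * norm (adjoint (?D x) \<mu>)) * norm \<mu>"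
          by (simp add: dot_square_norm power2_eq_square)
        then show ?thesis using \<mu> by (simp add: \<mu>_def)
      qed (use C in simp)
      then show ?case using elim by blast
    qed
  qed
qed

text \<open>With \<open>p = closest_point Q (k *\<^sub>R w)\<close>, the value \<open>p \<bullet> w - (norm p)\<^sup>2 / (2 * k)\<close> is the Moreau
  envelope of \<open>support_fun Q\<close> with parameter \<open>1 / k\<close> at \<open>w\<close>, and \<open>p\<close> is its gradient.\<close>

lemma closest_point_maximises:
  fixes Q :: "'a::euclidean_space set"
  assumes "closed Q" "q \<in> Q" "k > 0"
  defines "p \<equiv> \<lambda>w. closest_point Q (k *\<^sub>R w)"
  shows "q \<bullet> w - (norm q)\<^sup>2 / (2 * k) \<le> p w \<bullet> w - (norm (p w))\<^sup>2 / (2 * k)"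
proof -
  \<comment> \<open>Up to a term independent of \<open>q\<close>, the objective is
    \<open>- (dist (k *\<^sub>R w) q)\<^sup>2 / (2 * k)\<close>, so maximising it is
    projecting.\<close>
  have "dist (k *\<^sub>R w) (p w) \<le> dist (k *\<^sub>R w) q"
    unfolding p_def using assms by (intro closest_point_le)
  then have "(dist (k *\<^sub>R w) (p w))\<^sup>2 \<le> (dist (k *\<^sub>R w) q)\<^sup>2"
    by (intro power_mono) auto
  then have "2 * k * (q \<bullet> w) - (norm q)\<^sup>2 \<le> 2 * k * (p w \<bullet> w) - (norm (p w))\<^sup>2"
    unfolding dist_norm power2_norm_eq_inner
    by (simp add: inner_diff_left inner_diff_right inner_commute)
  then have "(2 * k * (q \<bullet> w) - (norm q)\<^sup>2) / (2 * k) \<le> (2 * k * (p w \<bullet> w) - (norm (p w))\<^sup>2) / (2 * k)"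
    using assms by (intro divide_right_mono) auto
  then show ?thesis using assms by (simp add: diff_divide_distrib)
qed

section \<open>Moreau regularisation and approximate multipliers\<close>

text \<open>First-order optimality for a regularised objective. The envelope need not be
  differentiated: freezing the projection at the displaced point bounds its increment from above,
  and continuity of the projection gives the limit of the quotients.\<close>

lemma moreau_envelope_critical_point:
  fixes F :: "'a::euclidean_space \<Rightarrow> 'b::euclidean_space" and x v :: 'a
  assumes Q: "Q \<noteq> {}" "closed Q" "convex Q" and C1: "C_k_on 1 F U" and U: "open U"
    and k: "k > 0" and \<delta>: "\<delta> \<ge> 0"
  defines "p \<equiv> \<lambda>y. closest_point Q (k *\<^sub>R F y)"
  defines "g \<equiv> \<lambda>y. p y \<bullet> F y - (norm (p y))\<^sup>2 / (2 * k) - v \<bullet> (y - x) + \<delta> * norm (y - x)"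
  assumes V: "open V" "y \<in> V" "V \<subseteq> U" and min: "\<And>z. z \<in> V \<Longrightarrow> g y \<le> g z"
  shows "norm (adjoint (frechet_derivative F (at y)) (p y) - v) \<le> \<delta>"
proof -
  let ?D = "frechet_derivative F (at y)"
  have yU: "y \<in> U" using V by auto
  have D: "(F has_derivative ?D) (at y)"
    using C_k_on_differentiable[OF C1[unfolded One_nat_def] yU] .
  have pQ: "p z \<in> Q" for z
    unfolding p_def using Q by (intro closest_point_in_set)
  have dir: "0 \<le> p y \<bullet> ?D u - v \<bullet> u + \<delta> * norm u" for u
  proof -
    have path: "((\<lambda>t. y + t *\<^sub>R u) \<longlongrightarrow> y) (at_right 0)"
      by (auto intro!: tendsto_eq_intros)
    have F: "isCont F y" using D has_derivative_continuous by blast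
    have "isCont (\<lambda>z. p z) y"
      unfolding p_def
      by (intro continuous_at_compose[of y "\<lambda>z. k *\<^sub>R F z" "closest_point Q", unfolded o_def]
          continuous_at_closest_point Q continuous_intros F)
    then have "((\<lambda>t. p (y + t *\<^sub>R u)) \<longlongrightarrow> p y) (at_right 0)"
      using path by (rule isCont_tendsto_compose)
    moreover have "((\<lambda>t. (1 / t) *\<^sub>R (F (y + t *\<^sub>R u) - F y)) \<longlongrightarrow> ?D u) (at_right 0)"
    proof -
      have "filterlim (\<lambda>t. (t, u, y)) (at_right 0 \<times>\<^sub>F nhds u \<times>\<^sub>F nhds y) (at_right 0)"
        by (intro filterlim_Pair filterlim_ident tendsto_const)
      from filterlim_compose[OF difference_quotient_tendsto[OF C1 U yU] this]
      show ?thesis by simp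
    qed
    ultimately have lim: "((\<lambda>t. p (y + t *\<^sub>R u) \<bullet> ((1 / t) *\<^sub>R (F (y + t *\<^sub>R u) - F y)) - v \<bullet> u + \<delta> * norm u)
        \<longlongrightarrow> p y \<bullet> ?D u - v \<bullet> u + \<delta> * norm u) (at_right 0)"
      by (intro tendsto_intros)
    have "\<forall>\<^sub>F t in at_right 0. y + t *\<^sub>R u \<in> V"
      using topological_tendstoD[OF path V(1,2)] .
    then have "\<forall>\<^sub>F t in at_right 0.
        0 \<le> p (y + t *\<^sub>R u) \<bullet> ((1 / t) *\<^sub>R (F (y + t *\<^sub>R u) - F y)) - v \<bullet> u + \<delta> * norm u"
      using eventually_at_right_less[of 0]
    proof eventually_elim
      case (elim t)
      let ?z = "y + t *\<^sub>R u"
      \<comment> \<open>\<open>p ?z\<close> is merely a competitor at \<open>F y\<close>; thus the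
        envelope increases by at most \<open>p ?z \<bullet> (F ?z - F y)\<close>.\<close>
      have "p ?z \<bullet> F y - (norm (p ?z))\<^sup>2 / (2 * k) \<le> p y \<bullet> F y - (norm (p y))\<^sup>2 / (2 * k)"
        using closest_point_maximises[OF Q(2) pQ[of ?z] k, of "F y"] by (simp add: p_def)
      moreover have "g y \<le> g ?z" using min elim by blast
      moreover have "norm (?z - x) \<le> norm (y - x) + t * norm u"
        using norm_triangle_ineq[of "y - x" "t *\<^sub>R u"] elim by (simp add: algebra_simps)
      then have "\<delta> * norm (?z - x) \<le> \<delta> * norm (y - x) + t * (\<delta> * norm u)"
        using mult_left_mono[OF _ \<delta>, of "norm (?z - x)" "norm (y - x) + t * norm u"]
        by (simp add: algebra_simps)
      ultimately have "0 \<le> p ?z \<bullet> (F ?z - F y) - t * (v \<bullet> u) + t * (\<delta> * norm u)"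
        by (simp add: g_def inner_diff_right inner_add_right)
      then have "0 \<le> (1 / t) * (p ?z \<bullet> (F ?z - F y) - t * (v \<bullet> u) + t * (\<delta> * norm u))"
        using elim by simp
      then show ?case using elim by (simp add: algebra_simps)
    qed
    from tendsto_lowerbound[OF lim this] show ?thesis by simp
  qed
  \<comment> \<open>Testing the direction \<open>v - ?a\<close> bounds its squared norm by
    \<open>\<delta>\<close> times its norm.\<close>
  let ?a = "adjoint ?D (p y)"
  have "p y \<bullet> ?D (v - ?a) = ?a \<bullet> (v - ?a)"
    using adjoint_clauses(2)[OF has_derivative_linear[OF D]] by metis
  with dir[of "v - ?a"] have "norm (v - ?a) * norm (v - ?a) \<le> \<delta> * norm (v - ?a)"
    by (simp add: dot_square_norm[symmetric] power2_eq_square[symmetric] inner_diff_left)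
  then have "norm (v - ?a) \<le> \<delta>"
    using \<delta> by (cases "v = ?a") auto
  then show ?thesis by (simp add: norm_minus_commute)
qed

text \<open>Subtracting \<open>v\<close> and adding a small multiple of \<open>norm (y - x)\<close>
  makes \<open>x\<close> a strict local minimiser of \<open>\<phi>\<close>. With the Moreau envelope
  in place of the support function the objective is finite and continuous; its minimisers over a
  closed ball accumulate at \<open>x\<close>, and their projections serve as multipliers. The last
  conclusion is an approximate form of normality that becomes exact as \<open>\<epsilon>\<close>
  tends to 0.\<close>

lemma regular_subdiff_approximation:
  fixes F :: "'a::euclidean_space \<Rightarrow> 'b::euclidean_space"
  assumes Q: "Q \<noteq> {}" "closed Q" "convex Q" and C1: "C_k_on 1 F U" and U: "open U" "x \<in> U"
    and \<phi>: "\<And>y. y \<in> U \<Longrightarrow> \<phi> y = ereal c + support_fun Q (F y)"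
    and v: "v \<in> regular_subdiff \<phi> x" and \<epsilon>: "\<epsilon> > 0"
  shows "\<exists>y\<in>U. \<exists>q\<in>Q. dist y x < \<epsilon> \<and> norm (adjoint (frechet_derivative F (at y)) q - v) \<le> \<epsilon> \<and>
    (\<forall>q'\<in>Q. q' \<bullet> F y - \<epsilon> * (norm q')\<^sup>2 \<le> q \<bullet> F y)"
proof -
  obtain r where fin: "\<bar>\<phi> x\<bar> \<noteq> \<infinity>" and r: "r \<in> o[at x](\<lambda>y. norm (y - x))"
    and sub: "\<forall>\<^sub>F y in at x. \<phi> y \<ge> \<phi> x + ereal (v \<bullet> (y - x)) + ereal (r y)"
    using v by (auto simp: regular_subdiff_def)
  have "\<bar>support_fun Q (F x)\<bar> \<noteq> \<infinity>"
    using fin \<phi>[OF U(2)] by (cases "support_fun Q (F x)") auto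
  then obtain s0 where s0: "support_fun Q (F x) = ereal s0" by auto
  define \<delta> where "\<delta> = \<epsilon> / 2"
  have \<delta>: "\<delta> > 0" using \<epsilon> by (simp add: \<delta>_def)
  \<comment> \<open>The error of the subgradient inequality is kept to \<open>\<delta> / 2\<close>,
    so that the penalty with factor \<open>\<delta>\<close> retains a surplus at every point other
    than \<open>x\<close>.\<close>
  have "\<forall>\<^sub>F y in at x. norm (r y) \<le> \<delta> / 2 * norm (norm (y - x))"
    using landau_o.smallD[OF r, of "\<delta> / 2"] \<delta> by simp
  with sub have "\<forall>\<^sub>F y in at x. \<phi> y \<ge> ereal (c + s0 + v \<bullet> (y - x) - \<delta> / 2 * norm (y - x))"
  proof eventually_elim
    case (elim y)
    have "ereal (c + s0 + v \<bullet> (y - x) - \<delta> / 2 * norm (y - x))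
        \<le> \<phi> x + ereal (v \<bullet> (y - x)) + ereal (r y)"
      using elim(2) by (simp add: \<phi>[OF U(2)] s0)
    then show ?case using elim(1) by (rule order_trans)
  qed
  then obtain \<rho>1 where \<rho>1: "\<rho>1 > 0" "\<And>y. y \<noteq> x \<Longrightarrow> dist y x < \<rho>1 \<Longrightarrow>
      \<phi> y \<ge> ereal (c + s0 + v \<bullet> (y - x) - \<delta> / 2 * norm (y - x))"
    unfolding eventually_at by auto
  obtain \<rho>0 where \<rho>0: "\<rho>0 > 0" "cball x \<rho>0 \<subseteq> U" using U open_contains_cball by blast
  define \<rho> where "\<rho> = min \<rho>0 (min (\<rho>1 / 2) (\<epsilon> / 2))"
  have \<rho>: "\<rho> > 0" "\<rho> < \<rho>1" "\<rho> < \<epsilon>" "cball x \<rho> \<subseteq> U"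
    using \<rho>0 \<rho>1 \<epsilon> by (auto simp: \<rho>_def)
  \<comment> \<open>The real number \<open>a\<close> stands for an upper bound of the support
    function at \<open>F y\<close>, whose finiteness is not known beforehand.\<close>
  have lower: "s0 + v \<bullet> (y - x) - \<delta> / 2 * norm (y - x) \<le> a"
    if "y \<in> cball x \<rho>" and a: "\<And>q. q \<in> Q \<Longrightarrow> q \<bullet> F y \<le> a" for y a
  proof -
    have y: "y \<in> U" using that \<rho> by auto
    have "ereal (c + s0 + v \<bullet> (y - x) - \<delta> / 2 * norm (y - x)) \<le> \<phi> y"
    proof (cases "y = x")
      case True
      then show ?thesis using \<phi>[OF U(2)] s0 by simp
    next
      case False
      then show ?thesis using \<rho>1(2)[of y] that(1) \<rho> by (simp add: dist_commute)
    qed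
    also have "\<dots> \<le> ereal c + ereal a"
      unfolding \<phi>[OF y] using a by (intro add_left_mono) (simp add: support_fun_le_iff)
    finally show ?thesis by simp
  qed
  define k where "k n = real (Suc n)" for n
  have k: "k n > 0" for n by (simp add: k_def)
  define p where "p n y = closest_point Q (k n *\<^sub>R F y)" for n y
  define g where "g n y = p n y \<bullet> F y - (norm (p n y))\<^sup>2 / (2 * k n) - v \<bullet> (y - x) + \<delta> * norm (y - x)"
    for n y
  have pQ: "p n y \<in> Q" for n y
    unfolding p_def using Q by (intro closest_point_in_set)
  have pmax: "q \<bullet> F y - (norm q)\<^sup>2 / (2 * k n) \<le> p n y \<bullet> F y - (norm (p n y))\<^sup>2 / (2 * k n)"
    if "q \<in> Q" for n y q
    unfolding p_def using closest_point_maximises[OF Q(2) that k] .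
  have contF: "continuous_on (cball x \<rho>) F"
    using continuous_on_subset[OF C_k_on_continuous[OF C1] \<rho>(4)] .
  have "\<exists>y\<in>cball x \<rho>. \<forall>z\<in>cball x \<rho>. g n y \<le> g n z" for n
  proof (rule continuous_attains_inf)
    have "continuous_on (cball x \<rho>) (p n)"
      unfolding p_def
      by (intro continuous_on_compose2[OF continuous_on_closest_point[OF Q(3,2,1), of UNIV]]
          continuous_intros contF) auto
    then show "continuous_on (cball x \<rho>) (g n)"
      unfolding g_def using k[of n] by (intro continuous_intros contF) auto
  qed (use \<rho> in auto)
  then obtain Y where Y: "\<And>n. Y n \<in> cball x \<rho>" and min: "\<And>n z. z \<in> cball x \<rho> \<Longrightarrow> g n (Y n) \<le> g n z"
    by metis
  \<comment> \<open>The envelope lies below the support function, so \<open>x\<close> as competitor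
    bounds all minimal values by \<open>s0\<close>.\<close>
  have gx: "g n x \<le> s0" for n
  proof -
    have "ereal (p n x \<bullet> F x) \<le> ereal s0" using support_fun_ge[OF pQ, of n x "F x"] s0 by simp
    moreover have "0 \<le> (norm (p n x))\<^sup>2 / (2 * k n)" using k[of n] by simp
    ultimately show ?thesis by (simp add: g_def)
  qed
  obtain y R where y: "y \<in> cball x \<rho>" and R: "strict_mono R" "(Y \<circ> R) \<longlonglongrightarrow> y"
    using Y compact_cball[of x \<rho>] unfolding compact_def by metis
  have lim: "(\<lambda>n. Y (R n)) \<longlonglongrightarrow> y" using R(2) by (simp add: o_def)
  have inv: "(\<lambda>n. inverse (k n)) \<longlonglongrightarrow> 0"
    unfolding k_def by (rule LIMSEQ_inverse_real_of_nat)
  \<comment> \<open>For a fixed \<open>q\<close> the regularising term vanishes as \<open>k\<close>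
    grows, so the bound on the minimal values survives at the cluster point.\<close>
  have "q \<bullet> F y \<le> s0 + v \<bullet> (y - x) - \<delta> * norm (y - x)" if q: "q \<in> Q" for q
  proof (rule LIMSEQ_le)
    have FY: "(\<lambda>n. F (Y (R n))) \<longlonglongrightarrow> F y"
      using continuous_on_tendsto_compose[OF contF lim y] Y by simp
    have "(\<lambda>n. q \<bullet> F (Y (R n)) - (norm q)\<^sup>2 / 2 * ((\<lambda>n. inverse (k n)) \<circ> R) n)
        \<longlonglongrightarrow> q \<bullet> F y - (norm q)\<^sup>2 / 2 * 0"
      by (intro tendsto_intros FY LIMSEQ_subseq_LIMSEQ[OF inv R(1)])
    then show "(\<lambda>n. q \<bullet> F (Y (R n)) - (norm q)\<^sup>2 / 2 * inverse (k (R n))) \<longlonglongrightarrow> q \<bullet> F y"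
      by simp
    show "(\<lambda>n. s0 + v \<bullet> (Y (R n) - x) - \<delta> * norm (Y (R n) - x))
        \<longlonglongrightarrow> s0 + v \<bullet> (y - x) - \<delta> * norm (y - x)"
      by (intro tendsto_intros lim)
    show "\<exists>N. \<forall>n\<ge>N. q \<bullet> F (Y (R n)) - (norm q)\<^sup>2 / 2 * inverse (k (R n))
        \<le> s0 + v \<bullet> (Y (R n) - x) - \<delta> * norm (Y (R n) - x)"
    proof (intro exI[of _ 0] allI impI)
      fix n
      have eq: "(norm q)\<^sup>2 / 2 * inverse (k (R n)) = (norm q)\<^sup>2 / (2 * k (R n))"
        by (simp only: divide_inverse inverse_mult_distrib mult.assoc)
      have "g (R n) (Y (R n)) \<le> s0"
        using min[of x "R n"] gx[of "R n"] \<rho> by simp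
      then show "q \<bullet> F (Y (R n)) - (norm q)\<^sup>2 / 2 * inverse (k (R n))
        \<le> s0 + v \<bullet> (Y (R n) - x) - \<delta> * norm (Y (R n) - x)"
        using pmax[OF q, of "Y (R n)" "R n"] unfolding g_def eq by linarith
    qed
  qed
  \<comment> \<open>Both estimates hold at \<open>y\<close> with penalty factors
    \<open>\<delta> / 2\<close> and \<open>\<delta>\<close>, which is possible only at
    \<open>x\<close>.\<close>
  from lower[OF y this] have "\<delta> * norm (y - x) \<le> 0" by simp
  then have "y = x" using mult_pos_pos[OF \<delta>, of "norm (y - x)"] by (cases "y = x") auto
  \<comment> \<open>Minimisers close to \<open>x\<close> lie in the open ball, where the optimality
    condition applies.\<close>
  then have "\<forall>\<^sub>F n in sequentially. dist (Y (R n)) x < \<rho>"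
    using tendstoD[OF lim \<rho>(1)] by simp
  moreover have "\<forall>\<^sub>F n in sequentially. inverse (k (R n)) < \<epsilon>"
    using order_tendstoD(2)[OF LIMSEQ_subseq_LIMSEQ[OF inv R(1)] \<epsilon>] by (simp add: o_def)
  ultimately have "\<forall>\<^sub>F n in sequentially. dist (Y (R n)) x < \<rho> \<and> inverse (k (R n)) < \<epsilon>"
    by (rule eventually_conj)
  then obtain n where n: "dist (Y (R n)) x < \<rho>" "inverse (k (R n)) < \<epsilon>"
    using eventually_happens[of _ sequentially] by auto
  define m where "m = R n"
  have YU: "Y m \<in> U" using Y \<rho> by auto
  show ?thesis
  proof (intro bexI[of _ "Y m"] bexI[of _ "p m (Y m)"] conjI ballI)
    show "dist (Y m) x < \<epsilon>" using n \<rho> by (simp add: m_def)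
    have "norm (adjoint (frechet_derivative F (at (Y m))) (p m (Y m)) - v) \<le> \<delta>"
      unfolding p_def
    proof (rule moreau_envelope_critical_point[OF Q C1 U(1) k, where x = x])
      show "Y m \<in> ball x \<rho>" using n by (simp add: m_def dist_commute)
      show "ball x \<rho> \<subseteq> U" using \<rho> by auto
    qed (use \<delta> min[of _ m] in \<open>auto simp: g_def p_def\<close>)
    then show "norm (adjoint (frechet_derivative F (at (Y m))) (p m (Y m)) - v) \<le> \<epsilon>"
      using \<epsilon> by (simp add: \<delta>_def)
    fix q assume q: "q \<in> Q"
    have "(norm q)\<^sup>2 / (2 * k m) \<le> \<epsilon> * (norm q)\<^sup>2"
    proof -
      have "inverse (k m) / 2 \<le> \<epsilon>" using n(2) \<epsilon> by (simp add: m_def)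
      from mult_right_mono[OF this, of "(norm q)\<^sup>2"]
      have "(norm q)\<^sup>2 * (inverse (k m) / 2) \<le> \<epsilon> * (norm q)\<^sup>2"
        by (simp only: mult.commute) simp
      moreover have "(norm q)\<^sup>2 / (2 * k m) = (norm q)\<^sup>2 * (inverse (k m) / 2)"
        by (simp only: divide_inverse inverse_mult_distrib mult.commute[of "inverse 2"])
      ultimately show ?thesis by (simp only:)
    qed
    moreover have "0 \<le> (norm (p m (Y m)))\<^sup>2 / (2 * k m)" using k[of m] by simp
    ultimately show "q \<bullet> F (Y m) - \<epsilon> * (norm q)\<^sup>2 \<le> p m (Y m) \<bullet> F (Y m)"
      using pmax[OF q, of "Y m" m] by linarith
  qed (use YU pQ in auto)
qed

section \<open>Limits of multipliers and the chain rule\<close>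

text \<open>Pairing with a fixed \<open>b\<close> moves the adjoint back onto
  \<open>DF(y n) b\<close>, whose continuity is known for each direction.\<close>

lemma adjoint_derivative_tendsto:
  fixes F :: "'a::euclidean_space \<Rightarrow> 'b::euclidean_space"
  assumes C1: "C_k_on 1 F U" and U: "open U" "x \<in> U"
    and y: "(y \<longlongrightarrow> x) G" and q: "(q \<longlongrightarrow> q0) G"
  shows "((\<lambda>n. adjoint (frechet_derivative F (at (y n))) (q n))
    \<longlongrightarrow> adjoint (frechet_derivative F (at x)) q0) G"
proof -
  let ?D = "\<lambda>x. frechet_derivative F (at x)"
  have lin: "linear (?D z)" if "z \<in> U" for z
    using C1 that linear_frechet_derivative by auto
  have "((\<lambda>n. adjoint (?D (y n)) (q n) \<bullet> b) \<longlongrightarrow> adjoint (?D x) q0 \<bullet> b) G" for b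
  proof -
    have "isCont (\<lambda>z. ?D z b) x"
      using C1 U by (simp add: continuous_on_eq_continuous_at)
    from isCont_tendsto_compose[OF this y] have "((\<lambda>n. q n \<bullet> ?D (y n) b) \<longlongrightarrow> q0 \<bullet> ?D x b) G"
      by (intro tendsto_intros q)
    moreover have "\<forall>\<^sub>F n in G. q n \<bullet> ?D (y n) b = adjoint (?D (y n)) (q n) \<bullet> b"
      using topological_tendstoD[OF y U] by eventually_elim (simp add: adjoint_clauses(2) lin)
    ultimately show ?thesis
      using U by (simp add: adjoint_clauses(2)[OF lin] tendsto_cong)
  qed
  then show ?thesis by (auto intro: tendsto_componentwise_iff[THEN iffD2])
qed

text \<open>The error bound \<open>K\<close> keeps the multipliers in a ball because their images
  under the adjoints converge. A cluster point inherits maximality, that is normality, as the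
  tolerance \<open>e n\<close> vanishes.\<close>

lemma multiplier_closure:
  fixes F :: "'a::euclidean_space \<Rightarrow> 'b::euclidean_space"
  assumes Q: "closed Q" and C1: "C_k_on 1 F U" and U: "open U" "x \<in> U"
    and K: "\<And>z q. z \<in> U \<Longrightarrow> q \<in> Q \<Longrightarrow>
      norm (q - lam) \<le> \<kappa> * norm (adjoint (frechet_derivative F (at z)) (q - lam))"
    and y: "\<And>n. y n \<in> U" "y \<longlonglongrightarrow> x" and q: "\<And>n. q n \<in> Q"
    and v: "(\<lambda>n. adjoint (frechet_derivative F (at (y n))) (q n)) \<longlonglongrightarrow> v"
    and opt: "\<And>n q'. q' \<in> Q \<Longrightarrow> q' \<bullet> F (y n) - e n * (norm q')\<^sup>2 \<le> q n \<bullet> F (y n)"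
    and e: "e \<longlonglongrightarrow> 0"
  shows "\<exists>q. F x \<in> normal_cone Q q \<and> adjoint (frechet_derivative F (at x)) q = v"
proof -
  let ?D = "\<lambda>x. frechet_derivative F (at x)"
  have lin: "linear (?D z)" if "z \<in> U" for z
    using C1 that linear_frechet_derivative by auto
  have "(\<lambda>n. adjoint (?D (y n)) (q n) - adjoint (?D (y n)) lam) \<longlonglongrightarrow> v - adjoint (?D x) lam"
    by (intro tendsto_diff v adjoint_derivative_tendsto[OF C1 U y(2)] tendsto_const)
  then have "bounded (range (\<lambda>n. adjoint (?D (y n)) (q n) - adjoint (?D (y n)) lam))"
    by (rule convergent_imp_bounded)
  then obtain B where B: "\<And>n. norm (adjoint (?D (y n)) (q n) - adjoint (?D (y n)) lam) \<le> B"
    by (auto simp: bounded_iff)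
  have "norm (q n - lam) \<le> \<bar>\<kappa>\<bar> * B" for n
  proof -
    have "norm (q n - lam) \<le> \<kappa> * norm (adjoint (?D (y n)) (q n - lam))"
      using K y q by blast
    also have "adjoint (?D (y n)) (q n - lam) = adjoint (?D (y n)) (q n) - adjoint (?D (y n)) lam"
      by (rule linear_diff[OF adjoint_linear[OF lin[OF y(1)]]])
    also have "\<kappa> * norm \<dots> \<le> \<bar>\<kappa>\<bar> * B"
      using B by (intro mult_mono) auto
    finally show ?thesis .
  qed
  then have "q n \<in> cball lam (\<bar>\<kappa>\<bar> * B)" for n
    by (simp add: dist_norm norm_minus_commute)
  then obtain q0 r where r: "strict_mono (r :: nat \<Rightarrow> nat)" "(q \<circ> r) \<longlonglongrightarrow> q0"
    using compact_cball[of lam "\<bar>\<kappa>\<bar> * B"] unfolding compact_def by metis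
  have yr: "(y \<circ> r) \<longlonglongrightarrow> x" using y(2) r(1) by (rule LIMSEQ_subseq_LIMSEQ)
  have "isCont F x"
    using C_k_on_continuous[OF C1] U by (simp add: continuous_on_eq_continuous_at)
  from isCont_tendsto_compose[OF this yr] have Fr: "(\<lambda>n. F ((y \<circ> r) n)) \<longlonglongrightarrow> F x" .
  have q0: "q0 \<in> Q" using closed_sequentially[OF Q _ r(2)] q by simp
  have "q' \<bullet> F x \<le> q0 \<bullet> F x" if q': "q' \<in> Q" for q'
  proof (rule LIMSEQ_le)
    have "(\<lambda>n. q' \<bullet> F ((y \<circ> r) n) - (e \<circ> r) n * (norm q')\<^sup>2)
        \<longlonglongrightarrow> q' \<bullet> F x - 0 * (norm q')\<^sup>2"
      by (intro tendsto_intros Fr LIMSEQ_subseq_LIMSEQ[OF e r(1)])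
    then show "(\<lambda>n. q' \<bullet> F ((y \<circ> r) n) - (e \<circ> r) n * (norm q')\<^sup>2) \<longlonglongrightarrow> q' \<bullet> F x"
      by simp
    show "(\<lambda>n. (q \<circ> r) n \<bullet> F ((y \<circ> r) n)) \<longlonglongrightarrow> q0 \<bullet> F x"
      by (intro tendsto_intros Fr r)
  qed (use opt[OF q'] in auto)
  then have "F x \<in> normal_cone Q q0" using q0 by (simp add: normal_cone_mem_iff)
  moreover have "adjoint (?D x) q0 = v"
  proof (rule LIMSEQ_unique)
    show "(\<lambda>n. adjoint (?D ((y \<circ> r) n)) ((q \<circ> r) n)) \<longlonglongrightarrow> adjoint (?D x) q0"
      by (rule adjoint_derivative_tendsto[OF C1 U yr r(2)])
    show "(\<lambda>n. adjoint (?D ((y \<circ> r) n)) ((q \<circ> r) n)) \<longlonglongrightarrow> v"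
      using LIMSEQ_subseq_LIMSEQ[OF v r(1)] by (simp add: o_def)
  qed
  ultimately show ?thesis by blast
qed

text \<open>Each regular subgradient in the approximating sequence is replaced by an approximate
  multiplier. One sequence \<open>e\<close> governs the distance of the points, the error of the
  subgradient and the tolerance in the maximality, so \<open>multiplier_closure\<close> applies in
  the limit.\<close>

lemma limiting_subdiff_chain_rule:
  fixes F :: "'a::euclidean_space \<Rightarrow> 'b::euclidean_space"
  assumes Q: "Q \<noteq> {}" "closed Q" "convex Q" and C1: "C_k_on 1 F U" and U: "open U" "x \<in> U"
    and K: "\<And>z q. z \<in> U \<Longrightarrow> q \<in> Q \<Longrightarrow>
      norm (q - lam) \<le> \<kappa> * norm (adjoint (frechet_derivative F (at z)) (q - lam))"
    and \<phi>: "\<And>y. y \<in> U \<Longrightarrow> \<phi> y = ereal c + support_fun Q (F y)"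
    and v: "v \<in> limiting_subdiff \<phi> x"
  shows "\<exists>q. F x \<in> normal_cone Q q \<and> adjoint (frechet_derivative F (at x)) q = v"
proof -
  let ?D = "\<lambda>x. frechet_derivative F (at x)"
  obtain X0 W0 where X0: "X0 \<longlonglongrightarrow> x" and W0: "\<And>n. W0 n \<in> regular_subdiff \<phi> (X0 n)" "W0 \<longlonglongrightarrow> v"
    using v by (auto simp: limiting_subdiff_def)
  obtain N where N: "\<And>n. n \<ge> N \<Longrightarrow> X0 n \<in> U"
    using topological_tendstoD[OF X0 U] by (auto simp: eventually_sequentially)
  \<comment> \<open>Dropping the first \<open>N\<close> terms puts every point into
    \<open>U\<close>.\<close>
  define X where "X n = X0 (n + N)" for n
  define W where "W n = W0 (n + N)" for n
  have X: "X \<longlonglongrightarrow> x" "W \<longlonglongrightarrow> v"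
    unfolding X_def W_def using X0 W0 by (auto intro: LIMSEQ_ignore_initial_segment)
  define e where "e n = inverse (real (Suc n))" for n
  have e: "e \<longlonglongrightarrow> 0" unfolding e_def by (rule LIMSEQ_inverse_real_of_nat)
  have "\<exists>y q. y \<in> U \<and> q \<in> Q \<and> dist y (X n) < e n \<and> norm (adjoint (?D y) q - W n) \<le> e n \<and>
      (\<forall>q'\<in>Q. q' \<bullet> F y - e n * (norm q')\<^sup>2 \<le> q \<bullet> F y)" for n
    using regular_subdiff_approximation[OF Q C1 U(1) _ \<phi> W0(1)[of "n + N"], of "e n"] N[of "n + N"]
    by (auto simp: X_def W_def e_def)
  then obtain y q where yq: "\<And>n. y n \<in> U" "\<And>n. q n \<in> Q" "\<And>n. dist (y n) (X n) < e n"
      "\<And>n. norm (adjoint (?D (y n)) (q n) - W n) \<le> e n"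
      "\<And>n q'. q' \<in> Q \<Longrightarrow> q' \<bullet> F (y n) - e n * (norm q')\<^sup>2 \<le> q n \<bullet> F (y n)"
    by metis
  have "(\<lambda>n. y n - X n) \<longlonglongrightarrow> 0"
    using yq(3) by (intro Lim_null_comparison[OF _ e]) (simp add: dist_norm less_imp_le)
  from tendsto_add[OF this X(1)] have y: "y \<longlonglongrightarrow> x" by simp
  have "(\<lambda>n. adjoint (?D (y n)) (q n) - W n) \<longlonglongrightarrow> 0"
    using yq(4) by (intro Lim_null_comparison[OF _ e]) auto
  from tendsto_add[OF this X(2)] have "(\<lambda>n. adjoint (?D (y n)) (q n)) \<longlonglongrightarrow> v" by simp
  from multiplier_closure[OF Q(2) C1 U K yq(1) y yq(2) this yq(5) e] show ?thesis by blast
qed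

text \<open>The function \<open>q \<bullet> F y\<close> minorises \<open>support_fun Q (F y)\<close>
  and touches it at \<open>x\<close>; its first-order expansion makes the candidate a regular
  subgradient, and constant sequences make it a limiting one.\<close>

lemma adjoint_derivative_in_limiting_subdiff:
  fixes F :: "'a::euclidean_space \<Rightarrow> 'b::euclidean_space"
  assumes F: "(F has_derivative D) (at x)" and U: "open U" "x \<in> U"
    and \<phi>: "\<And>y. y \<in> U \<Longrightarrow> \<phi> y = ereal c + support_fun Q (F y)"
    and q: "F x \<in> normal_cone Q q"
  shows "adjoint D q \<in> limiting_subdiff \<phi> x"
proof -
  have eq: "\<phi> x = ereal (c + q \<bullet> F x)"
    using \<phi>[OF U(2)] support_fun_normal_cone[OF q] by simp
  have qQ: "q \<in> Q" using q by (simp add: normal_cone_mem_iff)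
  define r where "r y = q \<bullet> (F y - F x - D (y - x))" for y
  have lin: "linear D" using F by (rule has_derivative_linear)
  have "adjoint D q \<in> regular_subdiff \<phi> x"
    unfolding regular_subdiff_def
  proof (intro CollectI conjI bexI[of _ r])
    show "\<bar>\<phi> x\<bar> \<noteq> \<infinity>" using eq by simp
    have "\<forall>\<^sub>F y in at x. y \<in> U"
      using U by (simp add: eventually_at_in_open')
    then show "\<forall>\<^sub>F y in at x. \<phi> x + ereal (adjoint D q \<bullet> (y - x)) + ereal (r y) \<le> \<phi> y"
    proof eventually_elim
      case (elim y)
      have "\<phi> x + ereal (adjoint D q \<bullet> (y - x)) + ereal (r y) = ereal c + ereal (q \<bullet> F y)"
        using adjoint_clauses(2)[OF lin, of q "y - x"] by (simp add: eq r_def inner_diff_right)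
      also have "\<dots> \<le> \<phi> y"
        unfolding \<phi>[OF elim] by (intro add_left_mono support_fun_ge qQ)
      finally show ?case .
    qed
    show "r \<in> o[at x](\<lambda>y. norm (y - x))"
    proof (rule smalloI_tendsto)
      have "((\<lambda>y. norm (F y - F x - D (y - x)) / norm (y - x)) \<longlongrightarrow> 0) (at x)"
        using F unfolding has_derivative_iff_norm by blast
      from tendsto_mult_left[OF this, of "norm q"]
      have "((\<lambda>y. norm q * (norm (F y - F x - D (y - x)) / norm (y - x))) \<longlongrightarrow> 0) (at x)" by simp
      then show "((\<lambda>y. r y / norm (y - x)) \<longlongrightarrow> 0) (at x)"
      proof (rule Lim_null_comparison[rotated])
        show "\<forall>\<^sub>F y in at x. norm (r y / norm (y - x))
            \<le> norm q * (norm (F y - F x - D (y - x)) / norm (y - x))"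
          by (intro always_eventually allI)
            (simp add: r_def Cauchy_Schwarz_ineq2 divide_right_mono)
      qed
      show "\<forall>\<^sub>F y in at x. norm (y - x) \<noteq> 0"
        using eventually_neq_at_within[of x x UNIV] by eventually_elim simp
    qed
  qed
  then show ?thesis
    unfolding limiting_subdiff_def using eq
    by (intro CollectI conjI exI[of _ "\<lambda>_. x"] exI[of _ "\<lambda>_. adjoint D q"]) auto
qed

lemma C_k_on_1_ident: "C_k_on 1 (\<lambda>x. x) U"
  by simp

lemma adjoint_ident: "adjoint (\<lambda>x :: 'a::euclidean_space. x) = (\<lambda>x. x)"
  by (rule adjoint_unique) simp

text \<open>Both directions come from the chain rule results with the identity as \<open>F\<close>,
  for which the error bound around 0 holds with constant 1.\<close>

lemma limiting_subdiff_support_fun: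
  fixes Q :: "'a::euclidean_space set"
  assumes Q: "Q \<noteq> {}" "closed Q" "convex Q"
  shows "v \<in> limiting_subdiff (support_fun Q) z \<longleftrightarrow> z \<in> normal_cone Q v"
proof
  assume v: "v \<in> limiting_subdiff (support_fun Q) z"
  have "\<exists>q. z \<in> normal_cone Q q \<and> adjoint (frechet_derivative (\<lambda>x. x) (at z)) q = v"
  proof (rule limiting_subdiff_chain_rule[OF Q C_k_on_1_ident open_UNIV UNIV_I _ _ v])
    show "support_fun Q y = ereal 0 + support_fun Q y" for y by simp
    show "norm (q - 0) \<le> 1 * norm (adjoint (frechet_derivative (\<lambda>x. x) (at z)) (q - 0))" for z q :: 'a
      by (simp add: adjoint_ident)
  qed
  then show "z \<in> normal_cone Q v" by (simp add: adjoint_ident)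
next
  assume z: "z \<in> normal_cone Q v"
  have "adjoint (\<lambda>x. x) v \<in> limiting_subdiff (support_fun Q) z"
  proof (rule adjoint_derivative_in_limiting_subdiff[OF has_derivative_ident open_UNIV UNIV_I _ z])
    show "support_fun Q y = ereal 0 + support_fun Q y" for y by simp
  qed
  then show "v \<in> limiting_subdiff (support_fun Q) z" by (simp add: adjoint_ident)
qed

section \<open>The strict second subderivative\<close>

definition subdiff_graph_filter :: "('a::real_inner \<Rightarrow> ereal) \<Rightarrow> 'a \<Rightarrow> 'a \<Rightarrow> ('a \<times> 'a) filter" where
  "subdiff_graph_filter \<theta> xb vb = inf (nhds (xb, vb))
     (inf (filtercomap (\<lambda>(x, v). \<theta> x) (nhds (\<theta> xb))) (principal {(x, v). v \<in> limiting_subdiff \<theta> x}))"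

text \<open>Serves both ways: the identity yields the convergence of the components, and a curve
  with these four properties may be used to test the limit inferior.\<close>

lemma filterlim_subdiff_graph_filter:
  "filterlim (\<lambda>p. (X p, V p)) (subdiff_graph_filter \<theta> xb vb) G \<longleftrightarrow>
     (X \<longlongrightarrow> xb) G \<and> (V \<longlongrightarrow> vb) G \<and> ((\<lambda>p. \<theta> (X p)) \<longlongrightarrow> \<theta> xb) G \<and>
     (\<forall>\<^sub>F p in G. V p \<in> limiting_subdiff \<theta> (X p))"
proof -
  have "((\<lambda>p. (X p, V p)) \<longlongrightarrow> (xb, vb)) G \<longleftrightarrow> (X \<longlongrightarrow> xb) G \<and> (V \<longlongrightarrow> vb) G"
    using tendsto_fst[of "\<lambda>p. (X p, V p)" "(xb, vb)" G] tendsto_snd[of "\<lambda>p. (X p, V p)" "(xb, vb)" G]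
    by (auto intro: tendsto_Pair)
  then show ?thesis
    by (simp add: subdiff_graph_filter_def filterlim_inf filterlim_filtercomap_iff
        filterlim_principal o_def)
qed

lemma strict_second_subderiv_eq:
  "strict_second_subderiv \<theta> xb vb h =
     Liminf (at_right 0 \<times>\<^sub>F nhds h \<times>\<^sub>F subdiff_graph_filter \<theta> xb vb)
       (\<lambda>(t, h', x, v). second_quotient \<theta> x v t h')"
  by (simp add: strict_second_subderiv_def subdiff_graph_filter_def)

lemma strict_second_subderiv_filter_projections:
  fixes \<theta> :: "'a::real_inner \<Rightarrow> ereal" and xb vb h :: 'a
  defines "S \<equiv> at_right 0 \<times>\<^sub>F nhds h \<times>\<^sub>F subdiff_graph_filter \<theta> xb vb"
  shows "filterlim fst (at_right 0) S"
    and "((\<lambda>p. fst (snd p)) \<longlongrightarrow> h) S"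
    and "((\<lambda>p. fst (snd (snd p))) \<longlongrightarrow> xb) S"
    and "((\<lambda>p. snd (snd (snd p))) \<longlongrightarrow> vb) S"
    and "\<forall>\<^sub>F p in S. snd (snd (snd p)) \<in> limiting_subdiff \<theta> (fst (snd (snd p)))"
proof -
  show "filterlim fst (at_right 0) S"
    unfolding S_def by (rule filterlim_fst)
  show "((\<lambda>p. fst (snd p)) \<longlongrightarrow> h) S"
    unfolding S_def by (rule filterlim_compose[OF filterlim_fst filterlim_snd])
  have "filterlim (\<lambda>p. snd (snd p)) (subdiff_graph_filter \<theta> xb vb) S"
    unfolding S_def by (rule filterlim_compose[OF filterlim_snd filterlim_snd])
  then have "filterlim (\<lambda>p. (fst (snd (snd p)), snd (snd (snd p)))) (subdiff_graph_filter \<theta> xb vb) S"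
    by simp
  then show "((\<lambda>p. fst (snd (snd p))) \<longlongrightarrow> xb) S" "((\<lambda>p. snd (snd (snd p))) \<longlongrightarrow> vb) S"
    "\<forall>\<^sub>F p in S. snd (snd (snd p)) \<in> limiting_subdiff \<theta> (fst (snd (snd p)))"
    unfolding filterlim_subdiff_graph_filter by auto
qed

text \<open>Eventual lower bounds pull back along \<open>s\<close>. A single curve therefore bounds
  the strict second subderivative from above.\<close>

lemma Liminf_le_along:
  fixes f :: "'a \<Rightarrow> 'b::complete_linorder"
  assumes "filterlim s S G"
  shows "Liminf S f \<le> Liminf G (\<lambda>x. f (s x))"
  unfolding le_Liminf_iff
  using assms by (auto dest!: less_LiminfD simp: filterlim_iff)

text \<open>A subgradient \<open>q\<close> at \<open>z\<close> is a maximiser for \<open>z\<close>,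
  so the linear function \<open>q\<close> minorises the support function with equality at
  \<open>z\<close>; every quotient is nonnegative.\<close>

lemma strict_second_subderiv_support_fun_nonneg:
  fixes Q :: "'a::euclidean_space set"
  assumes Q: "Q \<noteq> {}" "closed Q" "convex Q"
  shows "0 \<le> strict_second_subderiv (support_fun Q) zb lam h"
  unfolding strict_second_subderiv_eq
proof (rule Liminf_bounded)
  let ?S = "at_right (0::real) \<times>\<^sub>F nhds h \<times>\<^sub>F subdiff_graph_filter (support_fun Q) zb lam"
  note S = strict_second_subderiv_filter_projections[where \<theta> = "support_fun Q" and xb = zb and vb = lam and h = h]
  have "\<forall>\<^sub>F p in ?S. 0 < fst p"
    using S(1) eventually_at_right_less[of 0] by (auto simp: filterlim_iff)
  then show "\<forall>\<^sub>F p in ?S. 0 \<le> (case p of (t, h', x, v) \<Rightarrow> second_quotient (support_fun Q) x v t h')"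
    using S(5)
  proof eventually_elim
    case (elim p)
    obtain t h' z q where p: "p = (t, h', z, q)" by (cases p)
    have t: "t > 0" and z: "z \<in> normal_cone Q q"
      using elim limiting_subdiff_support_fun[OF Q] by (auto simp: p)
    have "ereal (q \<bullet> (z + t *\<^sub>R h')) \<le> support_fun Q (z + t *\<^sub>R h')"
      using z by (intro support_fun_ge) (simp add: normal_cone_mem_iff)
    then have "0 \<le> support_fun Q (z + t *\<^sub>R h') - support_fun Q z - ereal (t * (q \<bullet> h'))"
      unfolding support_fun_normal_cone[OF z]
      by (cases "support_fun Q (z + t *\<^sub>R h')") (auto simp: inner_add_right)
    then show ?case
      using t by (simp add: p second_quotient_def zero_le_divide_ereal)
  qed
qed

text \<open>The increment of \<open>F\<close> is absorbed into the direction, so that only the second-order Taylor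
  remainder of \<open>F\<close> separates the two quotients.\<close>

lemma second_quotient_chain:
  fixes F :: "'a::euclidean_space \<Rightarrow> 'b::euclidean_space"
  assumes \<phi>: "\<phi> x = ereal c + support_fun Q (F x)"
      "\<phi> (x + t *\<^sub>R h) = ereal c + support_fun Q (F (x + t *\<^sub>R h))"
    and D: "linear D" and q: "F x \<in> normal_cone Q q" and t: "t > 0"
  shows "second_quotient \<phi> x (adjoint D q) t h =
    second_quotient (support_fun Q) (F x) q t ((1 / t) *\<^sub>R (F (x + t *\<^sub>R h) - F x)) +
    ereal (q \<bullet> ((1 / (t\<^sup>2 / 2)) *\<^sub>R (F (x + t *\<^sub>R h) - F x - t *\<^sub>R D h)))"
proof -
  let ?y = "F (x + t *\<^sub>R h)"
  have adj: "adjoint D q \<bullet> h = q \<bullet> D h" using adjoint_clauses(2)[OF D] .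
  have "ereal (q \<bullet> ?y) \<le> support_fun Q ?y"
    using q by (intro support_fun_ge) (simp add: normal_cone_mem_iff)
  then consider "support_fun Q ?y = \<infinity>" | s where "support_fun Q ?y = ereal s"
    by (cases "support_fun Q ?y") auto
  then show ?thesis
  proof cases
    case 1
    \<comment> \<open>Here both quotients are infinite, and the added remainder is finite.\<close>
    then show ?thesis
      unfolding second_quotient_def \<phi> support_fun_normal_cone[OF q] using t by simp
  next
    case 2
    have "(s - q \<bullet> F x - t * (q \<bullet> D h)) / (t\<^sup>2 / 2) = (s - q \<bullet> F x - q \<bullet> (?y - F x)) / (t\<^sup>2 / 2)
        + q \<bullet> (?y - F x - t *\<^sub>R D h) / (t\<^sup>2 / 2)"
      unfolding add_divide_distrib[symmetric] by (simp add: inner_diff_right)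
    then show ?thesis
      unfolding second_quotient_def \<phi> support_fun_normal_cone[OF q] using t 2
      by (simp add: adj)
  qed
qed

section \<open>Lower and upper bounds for the composite function\<close>

text \<open>Every admissible \<open>(t, h', x, v)\<close> for \<open>\<phi>\<close> is sent to
  \<open>(t, k, F x, q)\<close>, where \<open>q\<close> is a multiplier of \<open>v\<close> and
  \<open>k\<close> the difference quotient of \<open>F\<close>. This tends to the filter for the
  support function, and the quotients differ by a term converging to
  \<open>lam \<bullet> second_deriv F xb h h\<close>.\<close>

lemma strict_second_subderiv_lower_bound:
  fixes F :: "'a::euclidean_space \<Rightarrow> 'b::euclidean_space"
  assumes Q: "Q \<noteq> {}" "closed Q" "convex Q" and lam: "lam \<in> Q"
    and C2: "C_k_on 2 F U" and U: "open U" "xb \<in> U" and F0: "F xb = 0"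
    and K: "\<And>z q. z \<in> U \<Longrightarrow> q \<in> Q \<Longrightarrow>
      norm (q - lam) \<le> \<kappa> * norm (adjoint (frechet_derivative F (at z)) (q - lam))"
    and \<phi>: "\<And>y. y \<in> U \<Longrightarrow> \<phi> y = ereal c + support_fun Q (F y)"
  shows "strict_second_subderiv (support_fun Q) 0 lam (frechet_derivative F (at xb) h)
      + ereal (lam \<bullet> second_deriv F xb h h)
    \<le> strict_second_subderiv \<phi> xb (adjoint (frechet_derivative F (at xb)) lam) h"
    (is "?L + ereal ?R \<le> ?M")
proof -
  let ?D = "\<lambda>x. frechet_derivative F (at x)"
  let ?vb = "adjoint (?D xb) lam"
  let ?Ah = "?D xb h"
  define S where "S = at_right (0::real) \<times>\<^sub>F nhds h \<times>\<^sub>F subdiff_graph_filter \<phi> xb ?vb"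
  define T where "T = at_right (0::real) \<times>\<^sub>F nhds ?Ah \<times>\<^sub>F subdiff_graph_filter (support_fun Q) 0 lam"
  define t where "t p = fst p" for p :: "real \<times> 'a \<times> 'a \<times> 'a"
  define h' where "h' p = fst (snd p)" for p :: "real \<times> 'a \<times> 'a \<times> 'a"
  define x where "x p = fst (snd (snd p))" for p :: "real \<times> 'a \<times> 'a \<times> 'a"
  define v where "v p = snd (snd (snd p))" for p :: "real \<times> 'a \<times> 'a \<times> 'a"
  have tS: "filterlim t (at_right 0) S" and hS: "(h' \<longlongrightarrow> h) S" and xS: "(x \<longlongrightarrow> xb) S"
    and vS: "(v \<longlongrightarrow> ?vb) S" and evS: "\<forall>\<^sub>F p in S. v p \<in> limiting_subdiff \<phi> (x p)"
    unfolding S_def t_def[abs_def] h'_def[abs_def] x_def[abs_def] v_def[abs_def]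
    by (rule strict_second_subderiv_filter_projections)+
  have C1: "C_k_on 1 F U" using C_k_on_1_of_2(1)[OF C2] .
  have lin: "linear (?D z)" if "z \<in> U" for z
    using C1 that linear_frechet_derivative by auto
  have tpos: "\<forall>\<^sub>F p in S. 0 < t p"
    using tS eventually_at_right_less[of 0] by (auto simp: filterlim_iff)
  have xU: "\<forall>\<^sub>F p in S. x p \<in> U"
    using topological_tendstoD[OF xS U] .
  have t0: "(t \<longlongrightarrow> 0) S"
    using tS by (rule filterlim_mono) (auto simp: at_within_le_nhds)
  have "((\<lambda>p. x p + t p *\<^sub>R h' p) \<longlongrightarrow> xb + 0 *\<^sub>R h) S"
    by (intro tendsto_intros xS t0 hS)
  then have xtU: "\<forall>\<^sub>F p in S. x p + t p *\<^sub>R h' p \<in> U"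
    using topological_tendstoD[of _ xb S U] U by simp
  \<comment> \<open>The choice is meaningful eventually along \<open>S\<close>, by the chain
    rule.\<close>
  define q where "q p = (SOME q. F (x p) \<in> normal_cone Q q \<and> adjoint (?D (x p)) q = v p)" for p
  have q: "\<forall>\<^sub>F p in S. F (x p) \<in> normal_cone Q (q p) \<and> adjoint (?D (x p)) (q p) = v p"
    using xU evS
  proof eventually_elim
    case (elim p)
    from limiting_subdiff_chain_rule[OF Q C1 U(1) elim(1) K \<phi> elim(2)]
    show ?case unfolding q_def by (rule someI_ex)
  qed
  \<comment> \<open>The error bound controls \<open>q p - lam\<close> by the difference of the
    images under the adjoint, namely \<open>v p\<close> minus that of \<open>lam\<close>; both terms
    tend to \<open>?vb\<close>.\<close>
  have qS: "(q \<longlongrightarrow> lam) S"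
  proof -
    have "((\<lambda>p. \<kappa> * norm (v p - adjoint (?D (x p)) lam)) \<longlongrightarrow> \<kappa> * norm (?vb - ?vb)) S"
      by (intro tendsto_intros vS adjoint_derivative_tendsto[OF C1 U xS])
    then have lim: "((\<lambda>p. \<kappa> * norm (v p - adjoint (?D (x p)) lam)) \<longlongrightarrow> 0) S" by simp
    have "\<forall>\<^sub>F p in S. norm (q p - lam) \<le> \<kappa> * norm (v p - adjoint (?D (x p)) lam)"
      using q xU
    proof eventually_elim
      case (elim p)
      then have "norm (q p - lam) \<le> \<kappa> * norm (adjoint (?D (x p)) (q p - lam))"
        by (intro K) (auto simp: normal_cone_mem_iff)
      then show ?case
        using linear_diff[OF adjoint_linear[OF lin[OF elim(2)]], of "q p" lam] elim(1) by simp
    qed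
    from Lim_null_comparison[OF this lim] show ?thesis by (simp add: Lim_null[symmetric])
  qed
  have "isCont F xb"
    using C_k_on_continuous[OF C1] U by (simp add: continuous_on_eq_continuous_at)
  from isCont_tendsto_compose[OF this xS] have FS: "((\<lambda>p. F (x p)) \<longlongrightarrow> 0) S"
    by (simp add: F0)
  have thx: "filterlim (\<lambda>p. (t p, h' p, x p)) (at_right 0 \<times>\<^sub>F nhds h \<times>\<^sub>F nhds xb) S"
    by (intro filterlim_Pair tS hS xS)
  define k where "k p = (1 / t p) *\<^sub>R (F (x p + t p *\<^sub>R h' p) - F (x p))" for p
  have kS: "(k \<longlongrightarrow> ?Ah) S"
    using filterlim_compose[OF difference_quotient_tendsto[OF C1 U] thx] by (simp add: k_def[abs_def])
  define R where "R p = (1 / ((t p)\<^sup>2 / 2)) *\<^sub>R (F (x p + t p *\<^sub>R h' p) - F (x p) - t p *\<^sub>R ?D (x p) (h' p))"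
    for p
  have "(R \<longlongrightarrow> second_deriv F xb h h) S"
    using filterlim_compose[OF second_order_quotient_tendsto[OF C2 U] thx] by (simp add: R_def[abs_def])
  with qS have RS: "((\<lambda>p. q p \<bullet> R p) \<longlongrightarrow> ?R) S" by (rule tendsto_inner)
  have "filterlim (\<lambda>p. (t p, k p, F (x p), q p)) T S"
    unfolding T_def
  proof (intro filterlim_Pair tS kS)
    show "filterlim (\<lambda>p. (F (x p), q p)) (subdiff_graph_filter (support_fun Q) 0 lam) S"
      unfolding filterlim_subdiff_graph_filter
    proof (intro conjI FS qS)
      have "((\<lambda>p. ereal (q p \<bullet> F (x p))) \<longlongrightarrow> ereal (lam \<bullet> 0)) S"
        by (intro tendsto_intros qS FS)
      moreover have "\<forall>\<^sub>F p in S. support_fun Q (F (x p)) = ereal (q p \<bullet> F (x p))"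
        using q by eventually_elim (simp add: support_fun_normal_cone)
      moreover have "support_fun Q 0 = ereal (lam \<bullet> 0)"
        using lam by (intro support_fun_normal_cone) (simp add: normal_cone_mem_iff)
      ultimately show "((\<lambda>p. support_fun Q (F (x p))) \<longlongrightarrow> support_fun Q 0) S"
        by (simp add: tendsto_cong)
      show "\<forall>\<^sub>F p in S. q p \<in> limiting_subdiff (support_fun Q) (F (x p))"
        using q by eventually_elim (simp add: limiting_subdiff_support_fun[OF Q])
    qed
  qed
  note TS = this
  have eq: "\<forall>\<^sub>F p in S. second_quotient \<phi> (x p) (v p) (t p) (h' p) =
      second_quotient (support_fun Q) (F (x p)) (q p) (t p) (k p) + ereal (q p \<bullet> R p)"
    using q xU xtU tpos
  proof eventually_elim
    case (elim p)
    have "second_quotient \<phi> (x p) (adjoint (?D (x p)) (q p)) (t p) (h' p) =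
        second_quotient (support_fun Q) (F (x p)) (q p) (t p) (k p) + ereal (q p \<bullet> R p)"
      unfolding k_def R_def using elim by (intro second_quotient_chain[of _ _ c] \<phi> lin) auto
    then show ?case using elim(1) by simp
  qed
  have M: "?M = Liminf S (\<lambda>p. second_quotient \<phi> (x p) (v p) (t p) (h' p))"
    unfolding strict_second_subderiv_eq S_def[symmetric]
    by (simp add: t_def h'_def x_def v_def case_prod_unfold)
  \<comment> \<open>The value \<open>?L\<close> may be infinite, so it is approached by strict lower
    bounds \<open>a\<close>, with a real error \<open>e\<close> for the convergent term.\<close>
  have eps: "a + ereal ?R \<le> ?M + ereal e" if a: "a < ?L" and e: "e > 0" for a :: ereal and e :: real
  proof -
    have "\<forall>\<^sub>F p in T. a < (case p of (t, h', x, v) \<Rightarrow> second_quotient (support_fun Q) x v t h')"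
      using a unfolding strict_second_subderiv_eq T_def[symmetric] by (rule less_LiminfD)
    with TS have "\<forall>\<^sub>F p in S. a < second_quotient (support_fun Q) (F (x p)) (q p) (t p) (k p)"
      by (auto simp: filterlim_iff)
    moreover have "\<forall>\<^sub>F p in S. ?R - e < q p \<bullet> R p"
      using order_tendstoD(1)[OF RS, of "?R - e"] e by simp
    ultimately have "\<forall>\<^sub>F p in S. a + ereal (?R - e) \<le> second_quotient \<phi> (x p) (v p) (t p) (h' p)"
      using eq
    proof eventually_elim
      case (elim p)
      then show ?case by (simp add: add_mono less_imp_le)
    qed
    then have "a + ereal (?R - e) \<le> ?M" unfolding M by (rule Liminf_bounded)
    then have "(a + ereal (?R - e)) + ereal e \<le> ?M + ereal e" by (rule add_right_mono)
    moreover have "(a + ereal (?R - e)) + ereal e = a + ereal ?R" by (cases a) auto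
    ultimately show ?thesis by simp
  qed
  have "?L \<le> ?M - ereal ?R"
  proof (rule dense_le)
    fix a assume "a < ?L"
    have "a + ereal ?R \<le> ?M"
      by (rule ereal_le_epsilon2) (rule eps[OF \<open>a < ?L\<close>])
    then show "a \<le> ?M - ereal ?R" by (subst ereal_le_minus) auto
  qed
  then show ?thesis by (subst (asm) ereal_le_minus) auto
qed

text \<open>One curve suffices: base points and displaced points are both mapped into
  \<open>normal_cone Q lam\<close>, where the support function is linear.\<close>

lemma strict_second_subderiv_upper_bound:
  fixes F :: "'a::euclidean_space \<Rightarrow> 'b::euclidean_space"
  assumes lam: "lam \<in> Q"
    and C2: "C_k_on 2 F U" and U: "open U" "xb \<in> U" and F0: "F xb = 0"
    and surj: "{frechet_derivative F (at xb) u - w | u w. w \<in> normal_cone Q lam} = UNIV"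
    and \<phi>: "\<And>y. y \<in> U \<Longrightarrow> \<phi> y = ereal c + support_fun Q (F y)"
    and h: "frechet_derivative F (at xb) h \<in> affine hull (normal_cone Q lam)"
  shows "strict_second_subderiv \<phi> xb (adjoint (frechet_derivative F (at xb)) lam) h
    \<le> ereal (lam \<bullet> second_deriv F xb h h)"
proof -
  let ?D = "\<lambda>x. frechet_derivative F (at x)"
  let ?vb = "adjoint (?D xb) lam"
  let ?N = "normal_cone Q lam"
  have C1: "C_k_on 1 F U" using C_k_on_1_of_2(1)[OF C2] .
  have deriv: "(F has_derivative ?D x) (at x)" if "x \<in> U" for x
    using C_k_on_differentiable[OF C1[unfolded One_nat_def] that] .
  have lin: "linear (?D x)" if "x \<in> U" for x
    using deriv[OF that] by (rule has_derivative_linear)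
  have N: "convex_cone ?N" using lam by (rule convex_cone_normal_cone)
  obtain w w' where w: "?D xb h = w - w'" "w \<in> ?N" "w' \<in> ?N"
    using h affine_hull_convex_cone_subset[OF N] by blast
  \<comment> \<open>Adding \<open>w''\<close> to both \<open>w\<close> and \<open>w'\<close> leaves
    their difference unchanged and puts the second into the range of \<open>DF(xb)\<close>. This
    yields a \<open>u\<close> for which \<open>u\<close> and \<open>u + h\<close> are both mapped
    into the cone.\<close>
  have "w' \<in> {?D xb u - w | u w. w \<in> ?N}" unfolding surj by simp
  then obtain u w'' where u: "w' = ?D xb u - w''" "w'' \<in> ?N" by blast
  have "?D xb u = w' + w''" using u by simp
  then have uN: "?D xb u \<in> ?N" using convex_cone_add[OF N w(3) u(2)] by simp
  have "?D xb (u + h) = w + w''"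
    using u w(1) by (simp add: linear_add[OF lin[OF U(2)]])
  then have uhN: "?D xb (u + h) \<in> ?N" using convex_cone_add[OF N w(2) u(2)] by simp
  note path = cone_tangent_path[OF C_k_on_continuous[OF C1] deriv[OF U(2)] F0 U N surj]
  obtain p where p: "(p \<longlongrightarrow> u) (at_right 0)" "\<forall>\<^sub>F t in at_right 0. F (xb + t *\<^sub>R p t) \<in> ?N"
    using path[OF uN] by metis
  obtain p' where p': "(p' \<longlongrightarrow> u + h) (at_right 0)"
      "\<forall>\<^sub>F t in at_right 0. F (xb + t *\<^sub>R p' t) \<in> ?N"
    using path[OF uhN] by metis
  define x where "x t = xb + t *\<^sub>R p t" for t
  \<comment> \<open>With this direction, \<open>x t + t *\<^sub>R k t\<close> is the point of the
    second path.\<close>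
  define k where "k t = p' t - p t" for t
  let ?G = "at_right (0::real)"
  have t0: "((\<lambda>t. t) \<longlongrightarrow> 0) ?G" by (auto intro!: tendsto_eq_intros)
  have "(x \<longlongrightarrow> xb + 0 *\<^sub>R u) ?G" unfolding x_def[abs_def] by (intro tendsto_intros t0 p)
  then have x: "(x \<longlongrightarrow> xb) ?G" by simp
  have "(k \<longlongrightarrow> (u + h) - u) ?G" unfolding k_def[abs_def] by (intro tendsto_intros p p')
  then have k: "(k \<longlongrightarrow> h) ?G" by simp
  have xk: "x t + t *\<^sub>R k t = xb + t *\<^sub>R p' t" for t
    by (simp add: x_def k_def algebra_simps)
  have "((\<lambda>t. x t + t *\<^sub>R k t) \<longlongrightarrow> xb + 0 *\<^sub>R h) ?G"
    by (intro tendsto_intros x t0 k)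
  then have "\<forall>\<^sub>F t in ?G. x t + t *\<^sub>R k t \<in> U"
    using topological_tendstoD[of _ xb ?G U] U by simp
  moreover have "\<forall>\<^sub>F t in ?G. x t \<in> U" using topological_tendstoD[OF x U] .
  ultimately have ev: "\<forall>\<^sub>F t in ?G. 0 < t \<and> x t \<in> U \<and> x t + t *\<^sub>R k t \<in> U \<and>
      F (x t) \<in> ?N \<and> F (x t + t *\<^sub>R k t) \<in> ?N"
    using p(2) p'(2) eventually_at_right_less[of 0] unfolding xk
    by eventually_elim (simp add: x_def)
  \<comment> \<open>Since \<open>F (x t)\<close> is normal at \<open>lam\<close>, the multiplier
    \<open>lam\<close> can be kept constant along the curve.\<close>
  define v where "v t = adjoint (?D (x t)) lam" for t
  have "filterlim (\<lambda>t. (t, k t, x t, v t)) (?G \<times>\<^sub>F nhds h \<times>\<^sub>F subdiff_graph_filter \<phi> xb ?vb) ?G"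
  proof (intro filterlim_Pair filterlim_ident k)
    show "filterlim (\<lambda>t. (x t, v t)) (subdiff_graph_filter \<phi> xb ?vb) ?G"
      unfolding filterlim_subdiff_graph_filter
    proof (intro conjI x)
      show "(v \<longlongrightarrow> ?vb) ?G"
        unfolding v_def[abs_def] by (rule adjoint_derivative_tendsto[OF C1 U x tendsto_const])
      have "isCont F xb"
        using deriv[OF U(2)] has_derivative_continuous by blast
      then have "((\<lambda>t. ereal (c + lam \<bullet> F (x t))) \<longlongrightarrow> ereal (c + lam \<bullet> F xb)) ?G"
        by (intro tendsto_intros isCont_tendsto_compose[OF _ x])
      moreover have "\<forall>\<^sub>F t in ?G. \<phi> (x t) = ereal (c + lam \<bullet> F (x t))"
        using ev by eventually_elim (simp add: \<phi> support_fun_normal_cone[of _ Q lam])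
      moreover have "F xb \<in> ?N" using N by (simp add: F0 convex_cone_iff)
      then have "\<phi> xb = ereal (c + lam \<bullet> F xb)"
        by (simp add: \<phi>[OF U(2)] support_fun_normal_cone[of _ Q lam])
      ultimately show "((\<lambda>t. \<phi> (x t)) \<longlongrightarrow> \<phi> xb) ?G"
        by (simp add: tendsto_cong)
      show "\<forall>\<^sub>F t in ?G. v t \<in> limiting_subdiff \<phi> (x t)"
        using ev
      proof eventually_elim
        case (elim t)
        then show ?case
          unfolding v_def using adjoint_derivative_in_limiting_subdiff[OF deriv U(1) _ \<phi>] by blast
      qed
    qed
  qed
  from Liminf_le_along[OF this, of "\<lambda>(t, h', x, v). second_quotient \<phi> x v t h'"]
  have "strict_second_subderiv \<phi> xb ?vb h \<le> Liminf ?G (\<lambda>t. second_quotient \<phi> (x t) (v t) t (k t))"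
    unfolding strict_second_subderiv_eq by simp
  also have "\<dots> = ereal (lam \<bullet> second_deriv F xb h h)"
  proof (rule lim_imp_Liminf)
    have "filterlim (\<lambda>t. (t, k t, x t)) (?G \<times>\<^sub>F nhds h \<times>\<^sub>F nhds xb) ?G"
      by (intro filterlim_Pair filterlim_ident k x)
    from filterlim_compose[OF second_order_quotient_tendsto[OF C2 U] this]
    have "((\<lambda>t. ereal (lam \<bullet> ((1 / (t\<^sup>2 / 2)) *\<^sub>R (F (x t + t *\<^sub>R k t) - F (x t) - t *\<^sub>R ?D (x t) (k t)))))
        \<longlongrightarrow> ereal (lam \<bullet> second_deriv F xb h h)) ?G"
      by (intro tendsto_intros) simp
    moreover have "\<forall>\<^sub>F t in ?G. second_quotient \<phi> (x t) (v t) t (k t) =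
        ereal (lam \<bullet> ((1 / (t\<^sup>2 / 2)) *\<^sub>R (F (x t + t *\<^sub>R k t) - F (x t) - t *\<^sub>R ?D (x t) (k t))))"
      using ev
    proof eventually_elim
      case (elim t)
      let ?k = "(1 / t) *\<^sub>R (F (x t + t *\<^sub>R k t) - F (x t))"
      have "second_quotient \<phi> (x t) (v t) t (k t) = second_quotient (support_fun Q) (F (x t)) lam t ?k +
        ereal (lam \<bullet> ((1 / (t\<^sup>2 / 2)) *\<^sub>R (F (x t + t *\<^sub>R k t) - F (x t) - t *\<^sub>R ?D (x t) (k t))))"
        unfolding v_def using elim by (intro second_quotient_chain[of _ _ c] \<phi> lin) auto
      moreover have "second_quotient (support_fun Q) (F (x t)) lam t ?k = 0"
        using elim
        by (simp add: second_quotient_def support_fun_normal_cone[of _ Q lam] inner_diff_right zero_ereal_def)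
      ultimately show ?case by simp
    qed
    ultimately show "((\<lambda>t. second_quotient \<phi> (x t) (v t) t (k t))
        \<longlongrightarrow> ereal (lam \<bullet> second_deriv F xb h h)) ?G"
      by (simp add: tendsto_cong)
  qed simp
  finally show ?thesis .
qed

theorem theorem3p8:
  fixes \<phi> :: "real^'n \<Rightarrow> ereal" and \<phi>d :: "real^'m \<Rightarrow> ereal"
    and F :: "real^'n \<Rightarrow> real^'m" and Q :: "(real^'m) set"
    and xb :: "real^'n" and lam :: "real^'m"
  assumes "proper_fun \<phi>" and "lsc_fun \<phi>"
    and "strictly_decomposable_at 2 \<phi> xb \<phi>d F Q lam"
  shows "(\<forall>h. strict_second_subderiv \<phi> xb (transpose (jacobian F (at xb)) *v lam) h
              \<ge> strict_second_subderiv \<phi>d 0 lam (jacobian F (at xb) *v h)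
                + ereal (lam \<bullet> second_deriv F xb h h)) \<and>
         (\<forall>h \<in> (\<lambda>u. jacobian F (at xb) *v u) -` (affine hull (normal_cone Q lam)).
            strict_second_subderiv \<phi> xb (transpose (jacobian F (at xb)) *v lam) h
              = strict_second_subderiv \<phi>d 0 lam (jacobian F (at xb) *v h)
                + ereal (lam \<bullet> second_deriv F xb h h) \<and>
            strict_second_subderiv \<phi>d 0 lam (jacobian F (at xb) *v h) = 0)"
proof -
  let ?D = "\<lambda>x. frechet_derivative F (at x)"
  let ?J = "jacobian F (at xb)"
  obtain U where U: "open U" "xb \<in> U" and \<phi>: "\<And>x. x \<in> U \<Longrightarrow> \<phi> x = \<phi> xb + \<phi>d (F x)"
    and C2: "C_k_on 2 F U"
    using assms(3) unfolding strictly_decomposable_at_def decomposable_at_def by blast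
  have F0: "F xb = 0" and Q: "Q \<noteq> {}" "closed Q" "convex Q" and \<phi>d: "\<phi>d = support_fun Q"
    and lam: "lam \<in> Q" and surjJ: "{?J *v u - w | u w. w \<in> normal_cone Q lam} = UNIV"
    and fin: "\<phi> xb < \<infinity>"
    using assms(3) unfolding strictly_decomposable_at_def decomposable_at_def edom_def by auto
  have "\<phi> xb \<noteq> -\<infinity>" using assms(1) by (simp add: proper_fun_def)
  with fin obtain c where c: "\<phi> xb = ereal c" by (cases "\<phi> xb") auto
  have C1: "C_k_on 1 F U" using C_k_on_1_of_2(1)[OF C2] .
  have "F differentiable (at xb)" using C1 U by simp
  then have J: "(\<lambda>u. ?J *v u) = ?D xb"
    unfolding jacobian_works by (rule frechet_derivative_at)
  then have J': "?J *v u = ?D xb u" for u by metis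
  have Jt: "transpose ?J *v lam = adjoint (?D xb) lam"
    using adjoint_matrix[of ?J] unfolding J by metis
  have surj: "{?D xb u - w | u w. w \<in> normal_cone Q lam} = UNIV"
    using surjJ unfolding J' .
  \<comment> \<open>Shrinking to a ball makes the error bound and the decomposition hold on the same
    open set.\<close>
  obtain \<kappa> d where d: "d > 0" "ball xb d \<subseteq> U"
    and K: "\<And>x q. x \<in> ball xb d \<Longrightarrow> q \<in> Q \<Longrightarrow> norm (q - lam) \<le> \<kappa> * norm (adjoint (?D x) (q - lam))"
    using multiplier_error_bound[OF C1 U lam surj]
      eventually_happens[OF eventually_conj[OF eventually_at_right_less[of "0::real"]]]
    by (metis (no_types, lifting) trivial_limit_at_right_real)
  have xb: "xb \<in> ball xb d" using d by simp
  have C2': "C_k_on 2 F (ball xb d)" using C_k_on_subset[OF C2 d(2)] .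
  have \<phi>': "\<phi> x = ereal c + support_fun Q (F x)" if "x \<in> ball xb d" for x
    using \<phi>[of x] that d(2) c by (auto simp: \<phi>d)
  have lower: "strict_second_subderiv (support_fun Q) 0 lam (?D xb h) + ereal (lam \<bullet> second_deriv F xb h h)
      \<le> strict_second_subderiv \<phi> xb (adjoint (?D xb) lam) h" for h
    by (rule strict_second_subderiv_lower_bound[OF Q lam C2' open_ball xb F0 K \<phi>'])
  \<comment> \<open>The subderivative of the support function is nonnegative. Together with the
    lower and upper bounds, which contain the same finite second-order term, this forces it to be 0
    and gives equality.\<close>
  have "strict_second_subderiv \<phi> xb (adjoint (?D xb) lam) h
        = strict_second_subderiv (support_fun Q) 0 lam (?D xb h) + ereal (lam \<bullet> second_deriv F xb h h)
      \<and> strict_second_subderiv (support_fun Q) 0 lam (?D xb h) = 0"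
    if "?D xb h \<in> affine hull (normal_cone Q lam)" for h
    using lower[of h] strict_second_subderiv_support_fun_nonneg[OF Q, of 0 lam "?D xb h"]
      strict_second_subderiv_upper_bound[OF lam C2' open_ball xb F0 surj \<phi>' that]
    by (cases "strict_second_subderiv (support_fun Q) 0 lam (?D xb h)";
        cases "strict_second_subderiv \<phi> xb (adjoint (?D xb) lam) h") auto
  with lower show ?thesis
    unfolding J' Jt \<phi>d by auto
qed

end
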